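(* Let $\widetilde f:\widetilde{\mathcal X}\to B$, $B\subset\mathbb{P}^1$, be the smooth family of strict transforms of an equisingular pencil of nodal Calabi–Yau hypersurfaces in $\mathbb{P}^4$, so that $R^3\widetilde f_*\mathbb{C}$ underlies a polarized variation of Hodge structure of weight $3$ with Hodge numbers $(1,k,k,1)$. Let $p\in\mathbb{P}^1\setminus B$, let $N=\log(T_u)$ be the logarithm of the unipotent part of the local monodromy at $p$, acting on $H_{\mathbb{Q}}$, and let $W_\bullet$ be the weight filtration (centered at three) of the limit mixed Hodge structure $(W_\bullet,F^\bullet_\infty)$ at $p$. Put $n_2=\dim\operatorname{Im}N_2$, $m_2=\dim\operatorname{Ker}N_2$, $o=\dim M_{2,1}$ where $M_{2,1}=\operatorname{Ker}N\cap\operatorname{Im}N$, and $N_{i,j}=N_i\circ N_j$. Then the limit mixed Hodge structure is described as follows: (1) If $N=0$, it is pure of weight three. (2) If $N\ne0$ and $N^2=0$, there are two cases: (a) $N_1\neq0$, $N_3\neq0$ and $N_{2,1}=N_{3,2}=0$; (b) $N_1=N_3=0$ and $N_2\neq0$. In these cases $$\dim\operatorname{Gr}^W_i(H_{\mathbb{Q}})=\begin{cases}0 & i=0,1,5,6 \quad\text{(cases (a) and (b))},\\ n_2+2 & i=2,4\quad\text{(case (a))},\\ n_2 & i=2,4\quad\text{(case (b))},\\ 2(m_2-1)& i=3\quad\text{(case (a))},\\ 2(m_2+1)& i=3\quad\text{(case (b))}.\end{cases}$$ (3) If $N^2\neq0$ and $N^3=0$, then $$\dim\operatorname{Gr}^W_i(H_{\mathbb{Q}})=\begin{cases}0&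 i=0,6,\\ 2& i=1,5,\\ o-2& i=2,4,\\ 2(k+1-o)& i=3.\end{cases}$$
   Context: Setting: let $\bar{\mathcal X}\subset\mathbb{P}^4\times\mathbb{P}^1\to\mathbb{P}^1$ be a Lefschetz pencil of hypersurfaces in $\mathbb{P}^4$ and $B\subset\mathbb{P}^1$ a maximal non-empty open subset over which the family $f:\mathcal X\to B$ is real-analytically trivial with each fibre $X_t$ having exactly $m$ nodes as its singular locus $\Sigma_t$. For $t\in B$, $\widetilde X_t$ is the strict transform of $X_t$ in the blow-up of $\mathbb{P}^4$ along $\Sigma_t$ (a smooth projective variety), and $\widetilde f:\widetilde{\mathcal X}\to B$ is the smooth family formed by the $\widetilde X_t$. For Calabi–Yau threefolds, $\dim H^{3,0}(\widetilde X_t)=\dim H^{0,3}(\widetilde X_t)=1$ and $k=\dim H^{2,1}(\widetilde X_t)=\dim H^{1,2}(\widetilde X_t)$. $H_{\mathbb{Q}}$ denotes the fibre of $R^3\widetilde f_*\mathbb{Q}$. Limit MHS (Schmid): at $p\in\mathbb{P}^1\setminus B$ the local monodromy operator factors as $T=T_sT_u$ (semisimple and unipotent parts), and $N=\log T_u$ is nilpotent with $N^4=0$. The limit MHS at $p$ is $(W_\bullet,F^\bullet_\infty)$ with $W_\bullet$ the monodromy weight filtration of $N$ centered at $3$ (so $N(W_i)\subset W_{i-2}$ and $N^r:\operatorname{Gr}^W_{3+r}\cong\operatorname{Gr}^W_{3-r}$ for all $r \geq 0$) and $F_\infty^\bullet$ the limiting Hodge filtration. Set $H^{j,3-j}=F^j_\infty/F^{j+1}_\infty$,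 of dimension $1,k,k,1$ for $j=3,2,1,0$. By Griffiths transversality $N$ induces linear maps $$H^{3,0}\xrightarrow{N_1}H^{2,1}\xrightarrow{N_2}H^{1,2}\xrightarrow{N_3}H^{0,3}.$$ *)

theory Defs
  imports "HOL-Analysis.Analysis" "HOL-Homology.Homology"
begin

subsection \<open>Linear algebra over the rational and complex numbers\<close>

text \<open>
  A rational vector space of dimension \<open>CARD('n)\<close> is \<^typ>\<open>rat ^ 'n\<close>, its complexification is
  \<^typ>\<open>complex ^ 'n\<close>. All notions of subspace, span and dimension are the ones over the field of
  entries (prefix \<open>vec\<close>), not the real ones of the class \<open>euclidean_space\<close>.
\<close>

definition cmat :: "rat ^ 'n ^ 'm \<Rightarrow> complex ^ 'n ^ 'm" where
  "cmat = map_matrix of_rat"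

definition complexification :: "(rat ^ 'n) set \<Rightarrow> (complex ^ 'n) set" where
  "complexification U = vec.span ((\<lambda>v. \<chi> i. of_rat (v $ i)) ` U)"

definition cvec :: "complex ^ 'n \<Rightarrow> complex ^ 'n" where
  "cvec v = (\<chi> i. cnj (v $ i))"

definition subspace_sum :: "('a::field ^ 'n) set \<Rightarrow> ('a ^ 'n) set \<Rightarrow> ('a ^ 'n) set" where
  "subspace_sum U V = {x + y | x y. x \<in> U \<and> y \<in> V}"

definition matpow :: "'a::field ^ 'n ^ 'n \<Rightarrow> nat \<Rightarrow> 'a ^ 'n ^ 'n" where
  "matpow A k = (((**) A) ^^ k) (mat 1)"

text \<open>
  The quotient \<open>U / S\<close> as a set of cosets; its zero element is \<open>S\<close>. A subspace of a quotient by \<open>S\<close>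
  is a set \<open>Q\<close> of cosets of \<open>S\<close>; its dimension is that of its preimage \<open>\<Union>Q\<close> minus that of \<open>S\<close>.
\<close>

definition quot :: "('a::field ^ 'n) set \<Rightarrow> ('a ^ 'n) set \<Rightarrow> ('a ^ 'n) set set" where
  "quot U S = (\<lambda>x. (+) x ` S) ` U"

definition qdim :: "('a::field ^ 'n) set \<Rightarrow> ('a ^ 'n) set set \<Rightarrow> nat" where
  "qdim S Q = vec.dim (\<Union>Q) - vec.dim S"

text \<open>
  The map into a quotient by \<open>S\<close> that \<open>A\<close> induces on cosets: \<open>x + S'\<close> goes to \<open>A x + S\<close>
  whenever \<open>A\<close> maps \<open>S'\<close> into \<open>S\<close>.
\<close>

definition induced :: "'a::field ^ 'n ^ 'n \<Rightarrow> ('a ^ 'n) set \<Rightarrow> ('a ^ 'n) set \<Rightarrow> ('a ^ 'n) set" where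
  "induced A S X = {A *v x + s | x s. x \<in> X \<and> s \<in> S}"

definition unipotent :: "'a::field ^ 'n ^ 'n \<Rightarrow> bool" where
  "unipotent U \<longleftrightarrow> (\<exists>k. matpow (U - mat 1) k = 0)"

definition semisimple :: "'a::field ^ 'n ^ 'n \<Rightarrow> bool" where
  "semisimple A \<longleftrightarrow>
    (\<forall>U. vec.subspace U \<and> (*v) A ` U \<subseteq> U \<longrightarrow>
      (\<exists>V. vec.subspace V \<and> (*v) A ` V \<subseteq> V \<and> U \<inter> V = {0} \<and> subspace_sum U V = UNIV))"

text \<open>
  For unipotent \<open>U\<close> and nilpotent \<open>A\<close> the following truncations contain all non-zero terms of the
  logarithm and exponential series.
\<close>

definition unip_log :: "'a::field_char_0 ^ 'n ^ 'n \<Rightarrow> 'a ^ 'n ^ 'n" where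
  "unip_log U = (\<Sum>j = 1..CARD('n). mat ((-1) ^ (j + 1) / of_nat j) ** matpow (U - mat 1) j)"

definition nilp_exp :: "'a::field_char_0 ^ 'n ^ 'n \<Rightarrow> 'a ^ 'n ^ 'n" where
  "nilp_exp A = (\<Sum>j = 0..CARD('n). mat (1 / fact j) ** matpow A j)"

text \<open>
  Convergence in the Grassmannian along a filter. Since the dimensions agree eventually, it is
  enough that every vector of the limit is a limit of vectors of the moving subspaces.
\<close>

definition subspace_tendsto ::
    "('b \<Rightarrow> (complex ^ 'n) set) \<Rightarrow> (complex ^ 'n) set \<Rightarrow> 'b filter \<Rightarrow> bool" where
  "subspace_tendsto A L G \<longleftrightarrow>
    vec.subspace L \<and> (\<forall>\<^sub>F z in G. vec.subspace (A z) \<and> vec.dim (A z) = vec.dim L) \<and>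
    (\<forall>v\<in>L. \<exists>w. (\<forall>\<^sub>F z in G. w z \<in> A z) \<and> (w \<longlongrightarrow> v) G)"


subsection \<open>Hodge structures\<close>

definition decreasing_filtration :: "(int \<Rightarrow> (complex ^ 'n) set) \<Rightarrow> bool" where
  "decreasing_filtration F \<longleftrightarrow>
    (\<forall>j. vec.subspace (F j)) \<and> (\<forall>j. F (j + 1) \<subseteq> F j) \<and> (\<exists>a. F a = UNIV) \<and> (\<exists>b. F b = {0})"

definition increasing_filtration :: "(int \<Rightarrow> (rat ^ 'n) set) \<Rightarrow> bool" where
  "increasing_filtration W \<longleftrightarrow>
    (\<forall>i. vec.subspace (W i)) \<and> (\<forall>i. W i \<subseteq> W (i + 1)) \<and> (\<exists>a. W a = {0}) \<and> (\<exists>b. W b = UNIV)"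

text \<open>
  The filtration induced by \<open>F\<close> on \<open>U / S\<close>, given by preimages in \<open>U\<close>, and the condition that it
  is a Hodge structure of weight \<open>w\<close> there: \<open>U / S\<close> is the direct sum of its \<open>j\<close>-th step and the
  conjugate of its \<open>(w + 1 - j)\<close>-th step.
\<close>

definition induced_filtration ::
    "(int \<Rightarrow> (complex ^ 'n) set) \<Rightarrow> (complex ^ 'n) set \<Rightarrow> (complex ^ 'n) set \<Rightarrow> int \<Rightarrow> (complex ^ 'n) set" where
  "induced_filtration F U S j = subspace_sum (F j \<inter> U) S"

definition hodge_on_quotient ::
    "int \<Rightarrow> (int \<Rightarrow> (complex ^ 'n) set) \<Rightarrow> (complex ^ 'n) set \<Rightarrow> (complex ^ 'n) set \<Rightarrow> bool" where
  "hodge_on_quotient w F U S \<longleftrightarrow>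
    (\<forall>j. subspace_sum (induced_filtration F U S j) (cvec ` induced_filtration F U S (w + 1 - j)) = U \<and>
         induced_filtration F U S j \<inter> cvec ` induced_filtration F U S (w + 1 - j) = S)"

definition hodge_structure :: "int \<Rightarrow> (int \<Rightarrow> (complex ^ 'n) set) \<Rightarrow> bool" where
  "hodge_structure w F \<longleftrightarrow> decreasing_filtration F \<and> hodge_on_quotient w F UNIV {0}"

definition hodge_component :: "(int \<Rightarrow> (complex ^ 'n) set) \<Rightarrow> int \<Rightarrow> int \<Rightarrow> (complex ^ 'n) set" where
  "hodge_component F a b = F a \<inter> cvec ` F b"

definition mixed_hodge_structure ::
    "(int \<Rightarrow> (rat ^ 'n) set) \<Rightarrow> (int \<Rightarrow> (complex ^ 'n) set) \<Rightarrow> bool" where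
  "mixed_hodge_structure W F \<longleftrightarrow> increasing_filtration W \<and> decreasing_filtration F \<and>
    (\<forall>i. hodge_on_quotient i F (complexification (W i)) (complexification (W (i - 1))))"

definition gr_W :: "(int \<Rightarrow> (rat ^ 'n) set) \<Rightarrow> int \<Rightarrow> (rat ^ 'n) set set" where
  "gr_W W i = quot (W i) (W (i - 1))"

definition gr_W_dim :: "(int \<Rightarrow> (rat ^ 'n) set) \<Rightarrow> int \<Rightarrow> nat" where
  "gr_W_dim W i = qdim (W (i - 1)) (gr_W W i)"

definition gr_F :: "(int \<Rightarrow> (complex ^ 'n) set) \<Rightarrow> int \<Rightarrow> (complex ^ 'n) set set" where
  "gr_F F j = quot (F j) (F (j + 1))"

definition pure_mixed_hodge_structure ::
    "int \<Rightarrow> (int \<Rightarrow> (rat ^ 'n) set) \<Rightarrow> (int \<Rightarrow> (complex ^ 'n) set) \<Rightarrow> bool" where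
  "pure_mixed_hodge_structure w W F \<longleftrightarrow>
    mixed_hodge_structure W F \<and> (\<forall>i. i \<noteq> w \<longrightarrow> gr_W_dim W i = 0) \<and> hodge_structure w F"

definition monodromy_weight_filtration ::
    "int \<Rightarrow> rat ^ 'n ^ 'n \<Rightarrow> (int \<Rightarrow> (rat ^ 'n) set) \<Rightarrow> bool" where
  "monodromy_weight_filtration c N W \<longleftrightarrow> increasing_filtration W \<and>
    (\<forall>i. (*v) N ` W i \<subseteq> W (i - 2)) \<and>
    (\<forall>r::nat. bij_betw (induced (matpow N r) (W (c - int r - 1)))
                 (gr_W W (c + int r)) (gr_W W (c - int r)))"


subsection \<open>Variations of Hodge structure over an open subset of the complex plane\<close>

text \<open>
  A local system of rational vector spaces, as a representation of the fundamental groupoid of \<open>B\<close>.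
  Every stalk is identified with \<^typ>\<open>rat ^ 'n\<close> (independently of the other stalks), and \<open>tr g\<close> is
  the matrix of parallel transport along \<open>g\<close>, from the stalk at \<open>pathstart g\<close> to the stalk at
  \<open>pathfinish g\<close>.
\<close>

definition local_system :: "complex set \<Rightarrow> ((real \<Rightarrow> complex) \<Rightarrow> rat ^ 'n ^ 'n) \<Rightarrow> bool" where
  "local_system B tr \<longleftrightarrow>
    (\<forall>t\<in>B. tr (linepath t t) = mat 1) \<and>
    (\<forall>g h. path g \<and> path_image g \<subseteq> B \<and> path h \<and> path_image h \<subseteq> B \<and> pathfinish g = pathstart h
       \<longrightarrow> tr (g +++ h) = tr h ** tr g) \<and>
    (\<forall>g h. homotopic_paths B g h \<longrightarrow> tr g = tr h)"

text \<open>
  \<open>F j t\<close> is the \<open>j\<close>-th step of the Hodge filtration on the fibre at \<open>t\<close>. On a disc around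
  \<open>t0\<close>, parallel transport along segments to \<open>t0\<close> is a flat trivialisation.
\<close>

definition flat_chart ::
    "((real \<Rightarrow> complex) \<Rightarrow> rat ^ 'n ^ 'n) \<Rightarrow> (int \<Rightarrow> complex \<Rightarrow> (complex ^ 'n) set) \<Rightarrow>
     complex \<Rightarrow> int \<Rightarrow> complex \<Rightarrow> (complex ^ 'n) set" where
  "flat_chart tr F t0 j t = (*v) (cmat (tr (linepath t t0))) ` F j t"

text \<open>
  The steps of \<open>F\<close> are holomorphic subbundles, given locally by holomorphic frames \<open>e\<close>, and
  differentiating the frame of \<open>F j\<close> leads to \<open>F (j - 1)\<close> (Griffiths transversality).
\<close>

definition variation_of_hodge_structure ::
    "int \<Rightarrow> complex set \<Rightarrow> ((real \<Rightarrow> complex) \<Rightarrow> rat ^ 'n ^ 'n) \<Rightarrow>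
     (int \<Rightarrow> complex \<Rightarrow> (complex ^ 'n) set) \<Rightarrow> bool" where
  "variation_of_hodge_structure w B tr F \<longleftrightarrow> open B \<and> local_system B tr \<and>
    (\<forall>t\<in>B. hodge_structure w (\<lambda>j. F j t)) \<and>
    (\<forall>t0\<in>B. \<forall>j. \<exists>\<epsilon>>0. \<exists>(d::nat) (e :: nat \<Rightarrow> complex \<Rightarrow> complex ^ 'n).
       ball t0 \<epsilon> \<subseteq> B \<and>
       (\<forall>i<d. \<forall>c. (\<lambda>t. e i t $ c) holomorphic_on ball t0 \<epsilon>) \<and>
       (\<forall>t\<in>ball t0 \<epsilon>.
          flat_chart tr F t0 j t = vec.span ((\<lambda>i. e i t) ` {..<d}) \<and>
          vec.dim (flat_chart tr F t0 j t) = d \<and>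
          (\<forall>i<d. (\<chi> c. deriv (\<lambda>s. e i s $ c) t) \<in> flat_chart tr F t0 (j - 1) t)))"

definition bilinear_of :: "rat ^ 'n ^ 'n \<Rightarrow> complex ^ 'n \<Rightarrow> complex ^ 'n \<Rightarrow> complex" where
  "bilinear_of Q x y = (\<Sum>a\<in>UNIV. x $ a * (cmat Q *v y) $ a)"

text \<open>\<open>Q t\<close> is the Gram matrix of the polarization on the fibre at \<open>t\<close>.\<close>

definition polarization ::
    "int \<Rightarrow> complex set \<Rightarrow> ((real \<Rightarrow> complex) \<Rightarrow> rat ^ 'n ^ 'n) \<Rightarrow>
     (int \<Rightarrow> complex \<Rightarrow> (complex ^ 'n) set) \<Rightarrow> (complex \<Rightarrow> rat ^ 'n ^ 'n) \<Rightarrow> bool" where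
  "polarization w B tr F Q \<longleftrightarrow>
    (\<forall>g. path g \<and> path_image g \<subseteq> B \<longrightarrow>
       transpose (tr g) ** Q (pathfinish g) ** tr g = Q (pathstart g)) \<and>
    (\<forall>t\<in>B. transpose (Q t) = mat ((-1) powi w) ** Q t \<and>
       (\<forall>j. \<forall>x\<in>F j t. \<forall>y\<in>F (w + 1 - j) t. bilinear_of (Q t) x y = 0) \<and>
       (\<forall>a b. a + b = w \<longrightarrow>
          (\<forall>v\<in>hodge_component (\<lambda>j. F j t) a b - {0}.
             \<i> powi (a - b) * bilinear_of (Q t) v (cvec v) \<in> \<real> \<and>
             0 < Re (\<i> powi (a - b) * bilinear_of (Q t) v (cvec v)))))"


subsection \<open>The limit mixed Hodge structure at a puncture\<close>

text \<open>
  The universal covering of the punctured disc of radius \<open>r\<close> around \<open>p\<close>, by the closed upper half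
  plane. The reference fibre is the one at \<open>pcover p r 0 = p + r\<close>, and the local monodromy is the
  transport once counterclockwise around \<open>p\<close>.
\<close>

definition pcover :: "complex \<Rightarrow> real \<Rightarrow> complex \<Rightarrow> complex" where
  "pcover p r z = p + of_real r * exp (2 * of_real pi * \<i> * z)"

definition local_monodromy ::
    "((real \<Rightarrow> complex) \<Rightarrow> rat ^ 'n ^ 'n) \<Rightarrow> complex \<Rightarrow> real \<Rightarrow> rat ^ 'n ^ 'n" where
  "local_monodromy tr p r = tr (pcover p r \<circ> linepath 0 1)"

definition period_map ::
    "((real \<Rightarrow> complex) \<Rightarrow> rat ^ 'n ^ 'n) \<Rightarrow> (int \<Rightarrow> complex \<Rightarrow> (complex ^ 'n) set) \<Rightarrow>
     complex \<Rightarrow> real \<Rightarrow> int \<Rightarrow> complex \<Rightarrow> (complex ^ 'n) set" where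
  "period_map tr F p r j z = (*v) (cmat (tr (pcover p r \<circ> linepath z 0))) ` F j (pcover p r z)"

text \<open>
  With these conventions, \<open>period_map\<close> at \<open>z + 1\<close> is the image under the inverse of the local
  monodromy \<open>T = T\<^sub>s T\<^sub>u\<close> of its value at \<open>z\<close>. Hence the twist by \<open>exp (z N)\<close>, \<open>N = log T\<^sub>u\<close>, is
  invariant under \<open>z \<mapsto> z + 1\<close> up to \<open>T\<^sub>s\<close>, and no base change is needed before taking the limit when
  \<open>T\<^sub>s\<close> has finite order.
\<close>

definition limit_hodge_filtration ::
    "((real \<Rightarrow> complex) \<Rightarrow> rat ^ 'n ^ 'n) \<Rightarrow> (int \<Rightarrow> complex \<Rightarrow> (complex ^ 'n) set) \<Rightarrow>
     complex \<Rightarrow> real \<Rightarrow> rat ^ 'n ^ 'n \<Rightarrow> (int \<Rightarrow> (complex ^ 'n) set) \<Rightarrow> bool" where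
  "limit_hodge_filtration tr F p r N Finf \<longleftrightarrow>
    (\<forall>j. subspace_tendsto (\<lambda>z. (*v) (nilp_exp (mat z ** cmat N)) ` period_map tr F p r j z)
           (Finf j) (filtercomap Im at_top))"

text \<open>
  The last two conjuncts are Schmid's theorem: the two filtrations form a mixed Hodge structure,
  of which \<open>N\<close> is an endomorphism of type \<open>(-1, -1)\<close>.
\<close>

definition limit_mixed_hodge_structure ::
    "int \<Rightarrow> ((real \<Rightarrow> complex) \<Rightarrow> rat ^ 'n ^ 'n) \<Rightarrow> (int \<Rightarrow> complex \<Rightarrow> (complex ^ 'n) set) \<Rightarrow>
     complex \<Rightarrow> real \<Rightarrow> rat ^ 'n ^ 'n \<Rightarrow>
     (int \<Rightarrow> (rat ^ 'n) set) \<Rightarrow> (int \<Rightarrow> (complex ^ 'n) set) \<Rightarrow> bool" where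
  "limit_mixed_hodge_structure w tr F p r N W Finf \<longleftrightarrow>
    monodromy_weight_filtration w N W \<and>
    limit_hodge_filtration tr F p r N Finf \<and>
    mixed_hodge_structure W Finf \<and>
    (\<forall>j. (*v) (cmat N) ` Finf j \<subseteq> Finf (j - 1))"

definition jordan_decomposition :: "rat ^ 'n ^ 'n \<Rightarrow> rat ^ 'n ^ 'n \<Rightarrow> rat ^ 'n ^ 'n \<Rightarrow> bool" where
  "jordan_decomposition T Ts Tu \<longleftrightarrow>
    T = Ts ** Tu \<and> Ts ** Tu = Tu ** Ts \<and> semisimple Ts \<and> unipotent Tu"

text \<open>
  The map \<open>gr_F F j \<rightarrow> gr_F F (j - 1)\<close> induced by \<open>N\<close>; the zero element of its target is \<open>F j\<close>.
\<close>

definition gr_N :: "rat ^ 'n ^ 'n \<Rightarrow> (int \<Rightarrow> (complex ^ 'n) set) \<Rightarrow> int \<Rightarrow>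
    (complex ^ 'n) set \<Rightarrow> (complex ^ 'n) set" where
  "gr_N N F j = induced (cmat N) (F j)"

definition zero_map_on :: "('a \<Rightarrow> (complex ^ 'n) set) \<Rightarrow> 'a set \<Rightarrow> (complex ^ 'n) set \<Rightarrow> bool" where
  "zero_map_on f D S \<longleftrightarrow> (\<forall>X\<in>D. f X = S)"


subsection \<open>Nodal quintic threefolds and the local system of their strict transforms\<close>

type_synonym mat5 = "complex ^ 5 ^ 5"

definition quintic_form :: "(complex ^ 5 \<Rightarrow> complex) \<Rightarrow> bool" where
  "quintic_form G \<longleftrightarrow> (\<exists>c. \<forall>x. G x =
     (\<Sum>a | (\<Sum>i\<in>(UNIV :: 5 set). a i) = (5::nat). c a * (\<Prod>i\<in>UNIV. (x $ i) ^ a i)))"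

definition partial :: "(complex ^ 5 \<Rightarrow> complex) \<Rightarrow> 5 \<Rightarrow> complex ^ 5 \<Rightarrow> complex" where
  "partial G i x = deriv (\<lambda>s. G (x + s *s axis i 1)) 0"

definition gradient :: "(complex ^ 5 \<Rightarrow> complex) \<Rightarrow> complex ^ 5 \<Rightarrow> complex ^ 5" where
  "gradient G x = (\<chi> i. partial G i x)"

definition hessian :: "(complex ^ 5 \<Rightarrow> complex) \<Rightarrow> complex ^ 5 \<Rightarrow> complex ^ 5 ^ 5" where
  "hessian G x = (\<chi> i j. partial (partial G i) j x)"

text \<open>
  Complex projective 4-space as the compact space of orthogonal projectors of rank one: the line
  spanned by \<open>x \<noteq> 0\<close> is represented by the projector onto it.
\<close>

definition proj_pt :: "complex ^ 5 \<Rightarrow> complex ^ 5 ^ 5" where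
  "proj_pt x = (\<chi> i j. x $ i * cnj (x $ j) / of_real ((norm x)\<^sup>2))"

definition singular_point :: "(complex ^ 5 \<Rightarrow> complex) \<Rightarrow> complex ^ 5 \<Rightarrow> bool" where
  "singular_point G x \<longleftrightarrow> x \<noteq> 0 \<and> G x = 0 \<and> gradient G x = 0"

text \<open>
  At a singular point the Hessian annihilates \<open>x\<close> (Euler's relation); the point is a node if the
  quadratic form induced on the tangent space, the quotient by the line spanned by \<open>x\<close> (up to a
  twist), is nondegenerate.
\<close>

definition nodal :: "nat \<Rightarrow> (complex ^ 5 \<Rightarrow> complex) \<Rightarrow> bool" where
  "nodal m G \<longleftrightarrow>
    finite (proj_pt ` {x. singular_point G x}) \<and> card (proj_pt ` {x. singular_point G x}) = m \<and>
    (\<forall>x. singular_point G x \<longrightarrow> {v. hessian G x *v v = 0} = vec.span {x})"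

text \<open>
  The blow-up of projective space along a subscheme whose ideal is generated by forms of equal degree
  is the closure of the graph of the rational map given by these forms. For a nodal hypersurface the
  partial derivatives of the equation generate the ideal sheaf of the reduced set of nodes, because
  the Hessians are nondegenerate. The strict transform is the closure of the part of the graph over
  the smooth points.
\<close>

definition strict_transform :: "(complex ^ 5 \<Rightarrow> complex) \<Rightarrow> (mat5 \<times> mat5) set" where
  "strict_transform G =
    closure {(proj_pt x, proj_pt (gradient G x)) | x. x \<noteq> 0 \<and> G x = 0 \<and> gradient G x \<noteq> 0}"

text \<open>
  The pencil in an affine coordinate \<open>t\<close> of the projective line; the member at infinity is \<open>G1\<close>.
\<close>

definition pencil ::
    "(complex ^ 5 \<Rightarrow> complex) \<Rightarrow> (complex ^ 5 \<Rightarrow> complex) \<Rightarrow> complex \<Rightarrow> complex ^ 5 \<Rightarrow> complex" where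
  "pencil G0 G1 t x = G0 x + t * G1 x"

definition is_quintic_pencil :: "(complex ^ 5 \<Rightarrow> complex) \<Rightarrow> (complex ^ 5 \<Rightarrow> complex) \<Rightarrow> bool" where
  "is_quintic_pencil G0 G1 \<longleftrightarrow> quintic_form G0 \<and> quintic_form G1 \<and>
    (\<forall>a b. (\<forall>x. a * G0 x + b * G1 x = 0) \<longrightarrow> a = 0 \<and> b = 0)"

text \<open>The largest open set over which every member has exactly \<open>m\<close> nodes as its singularities.\<close>

definition equisingular_locus ::
    "nat \<Rightarrow> (complex ^ 5 \<Rightarrow> complex) \<Rightarrow> (complex ^ 5 \<Rightarrow> complex) \<Rightarrow> complex set" where
  "equisingular_locus m G0 G1 = interior {t. nodal m (pencil G0 G1 t)}"

definition fibre :: "(complex ^ 5 \<Rightarrow> complex) \<Rightarrow> (complex ^ 5 \<Rightarrow> complex) \<Rightarrow> complex \<Rightarrow>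
    (mat5 \<times> mat5) topology" where
  "fibre G0 G1 t = top_of_set (strict_transform (pencil G0 G1 t))"

definition family_over_path :: "(complex ^ 5 \<Rightarrow> complex) \<Rightarrow> (complex ^ 5 \<Rightarrow> complex) \<Rightarrow> (real \<Rightarrow> complex) \<Rightarrow>
    (real \<times> mat5 \<times> mat5) topology" where
  "family_over_path G0 G1 g =
    top_of_set {(s, y). s \<in> {0..1} \<and> y \<in> strict_transform (pencil G0 G1 (g s))}"

text \<open>
  The rational cohomology of degree 3 is \<open>Hom(H\<^sub>3, \<rat>)\<close>. The pairing \<open>ev t v c\<close> identifies \<open>v\<close> in
  \<^typ>\<open>rat ^ 'n\<close> with the functional \<open>ev t v\<close> on the third homology of the fibre at \<open>t\<close>, and
  transport along \<open>g\<close> is dual to the identification of the homology groups of the two end fibres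
  with that of the family over \<open>g\<close>. Thus \<open>tr\<close> is the local system \<open>R\<^sup>3 f\<^sub>* \<rat>\<close>.
\<close>

definition third_cohomology_local_system ::
    "(complex ^ 5 \<Rightarrow> complex) \<Rightarrow> (complex ^ 5 \<Rightarrow> complex) \<Rightarrow> complex set \<Rightarrow>
     (complex \<Rightarrow> rat ^ 'n \<Rightarrow> ((mat5 \<times> mat5) chain) set \<Rightarrow> rat) \<Rightarrow>
     ((real \<Rightarrow> complex) \<Rightarrow> rat ^ 'n ^ 'n) \<Rightarrow> bool" where
  "third_cohomology_local_system G0 G1 B ev tr \<longleftrightarrow> local_system B tr \<and>
    (\<forall>t\<in>B.
       (\<forall>u v. \<forall>a. \<forall>c\<in>carrier (homology_group 3 (fibre G0 G1 t)).
          ev t (u + a *s v) c = ev t u c + a * ev t v c) \<and>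
       bij_betw (\<lambda>v. restrict (ev t v) (carrier (homology_group 3 (fibre G0 G1 t)))) UNIV
         {\<phi> \<in> extensional (carrier (homology_group 3 (fibre G0 G1 t))).
            \<forall>c\<in>carrier (homology_group 3 (fibre G0 G1 t)).
            \<forall>d\<in>carrier (homology_group 3 (fibre G0 G1 t)).
              \<phi> (c \<otimes>\<^bsub>homology_group 3 (fibre G0 G1 t)\<^esub> d) = \<phi> c + \<phi> d}) \<and>
    (\<forall>g v. path g \<and> path_image g \<subseteq> B \<longrightarrow>
       (\<forall>c\<in>carrier (homology_group 3 (fibre G0 G1 (pathstart g))).
        \<forall>d\<in>carrier (homology_group 3 (fibre G0 G1 (pathfinish g))).
          hom_induced 3 (fibre G0 G1 (pathstart g)) {} (family_over_path G0 G1 g) {} (\<lambda>y. (0, y)) c =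
          hom_induced 3 (fibre G0 G1 (pathfinish g)) {} (family_over_path G0 G1 g) {} (\<lambda>y. (1, y)) d
          \<longrightarrow> ev (pathfinish g) (tr g *v v) d = ev (pathstart g) v c))"

end

theory Submission
  imports Defs
begin

text \<open>
  The geometry enters only through the dimensions of the steps of the limiting Hodge filtration: the
  transport matrices and \<open>exp (z N)\<close> are invertible, so these are the dimensions on a nearby fibre.
  What remains is linear algebra. Let \<open>f\<^sub>i(j)\<close> be the dimension of the \<open>j\<close>-th Hodge step on
  \<open>Gr\<^sub>i\<close>. The Hodge structure on \<open>Gr\<^sub>i\<close> gives \<open>f\<^sub>i(j) + f\<^sub>i(i + 1 - j) = dim Gr\<^sub>i\<close>, and the
  \<open>f\<^sub>i(3)\<close> add up to one. If \<open>N\<^sup>2 = 0\<close>, cases (a) and (b) are \<open>f\<^sub>4(3) = 1\<close> and \<open>f\<^sub>4(3) = 0\<close>.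
  If \<open>N\<^sup>2 \<noteq> 0 = N\<^sup>3\<close>, then \<open>f\<^sub>5(3) = 1\<close>, whence \<open>dim Gr\<^sub>5 = 2\<close>; the rest
  follows by counting ranks of \<open>N\<close> on the weight filtration.
\<close>

subsection \<open>Subspaces, quotients and complexification\<close>

text \<open>A linear section \<open>g\<close> of \<open>A\<close> over the image splits
  \<open>U\<close> into a copy of the image and the kernel of \<open>A\<close> on
  \<open>U\<close>.\<close>

lemma rank_nullity_on:
  fixes A :: "'a::field ^ 'n ^ 'm"
  assumes U: "vec.subspace U"
  shows "vec.dim ((*v) A ` U) + vec.dim {x \<in> U. A *v x = 0} = vec.dim U"
proof -
  let ?K = "{x \<in> U. A *v x = 0}"
  have lin: "Vector_Spaces.linear (*s) (*s) ((*v) A)" by simp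
  obtain g where g: "range g \<subseteq> U" "Vector_Spaces.linear (*s) (*s) g"
      "\<And>v. v \<in> (*v) A ` U \<Longrightarrow> A *v g v = v"
    using vec.linear_exists_right_inverse_on[OF lin U] by metis
  interpret g: Vector_Spaces.linear "(*s)" "(*s)" g by (rule g(2))
  let ?R = "g ` (*v) A ` U"
  have AU: "vec.subspace ((*v) A ` U)" using U by (rule vec.subspace_image)
  have R: "vec.subspace ?R" using AU by (rule g.subspace_image)
  have K: "vec.subspace ?K"
    using U by (auto simp: vec.subspace_def vec.add vec.scale matrix_vector_right_distrib)
  have "vec.dim ?R = vec.dim ((*v) A ` U)"
  proof (rule vec.dim_image_eq[OF g(2)])
    show "inj_on g (vec.span ((*v) A ` U))"
      unfolding vec.span_eq_iff[THEN iffD2, OF AU] by (rule inj_on_inverseI[of _ "(*v) A"]) (rule g(3))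
  qed
  moreover have "?R \<inter> ?K = {0}"
    using g(3) U vec.subspace_0[OF R] by (auto simp: vec.subspace_0 g.zero)
  moreover have "{x + y | x y. x \<in> ?R \<and> y \<in> ?K} = U"
  proof
    show "{x + y | x y. x \<in> ?R \<and> y \<in> ?K} \<subseteq> U" using g(1) U by (auto intro!: vec.subspace_add)
    show "U \<subseteq> {x + y | x y. x \<in> ?R \<and> y \<in> ?K}"
    proof
      fix x assume x: "x \<in> U"
      then have "x - g (A *v x) \<in> ?K"
        using U g by (auto simp: vec.diff matrix_vector_mult_diff_distrib intro!: vec.subspace_diff)
      moreover have "g (A *v x) \<in> ?R" using x by auto
      moreover have "x = g (A *v x) + (x - g (A *v x))" by simp
      ultimately show "x \<in> {x + y | x y. x \<in> ?R \<and> y \<in> ?K}" by blast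
    qed
  qed
  ultimately show ?thesis using vec.dim_sums_Int[OF R K] by simp
qed

lemma subspace_subspace_sum:
  "vec.subspace U \<Longrightarrow> vec.subspace V \<Longrightarrow> vec.subspace (subspace_sum U V)"
  unfolding subspace_sum_def by (rule vec.subspace_sums)

lemma dim_subspace_sum:
  "vec.subspace U \<Longrightarrow> vec.subspace V \<Longrightarrow>
    vec.dim (subspace_sum U V) + vec.dim (U \<inter> V) = vec.dim U + vec.dim V"
  unfolding subspace_sum_def by (rule vec.dim_sums_Int)

lemma subspace_sum_upper2:
  assumes "vec.subspace U"
  shows "V \<subseteq> subspace_sum U V"
  using vec.subspace_0[OF assms] unfolding subspace_sum_def by (auto, metis add.left_neutral)

lemma dim_subspace_0_iff: "vec.subspace U \<Longrightarrow> vec.dim U = 0 \<longleftrightarrow> U = {0}"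
  using vec.subspace_0 by auto

section \<open>Quotients as sets of cosets\<close>

lemma Union_quot:
  assumes "vec.subspace U" "vec.subspace S" "S \<subseteq> U"
  shows "\<Union> (quot U S) = U"
proof
  show "\<Union> (quot U S) \<subseteq> U" using assms by (auto simp: quot_def intro!: vec.subspace_add)
  show "U \<subseteq> \<Union> (quot U S)"
    using vec.subspace_0[OF assms(2)] by (force simp: quot_def)
qed

text \<open>Serves for images of induced maps, whose representatives \<open>U\<close> need not
  contain \<open>S\<close>.\<close>

lemma Union_cosets: "\<Union> ((\<lambda>x. (+) x ` S) ` U) = subspace_sum U S"
  unfolding subspace_sum_def image_def by blast

lemma coset_eq_iff:
  assumes S: "vec.subspace S"
  shows "(+) x ` S = (+) y ` S \<longleftrightarrow> x - y \<in> S"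
proof
  assume "(+) x ` S = (+) y ` S"
  then have "x + 0 \<in> (+) y ` S" using vec.subspace_0[OF S] by blast
  then show "x - y \<in> S" by (auto simp: algebra_simps)
next
  assume *: "x - y \<in> S"
  have "(+) x ` S \<subseteq> (+) y ` S" if "x - y \<in> S" for x y
  proof
    fix z assume "z \<in> (+) x ` S"
    then obtain s where "s \<in> S" "z = x + s" by auto
    then have "z = y + ((x - y) + s)" "(x - y) + s \<in> S" using that S by (auto intro: vec.subspace_add)
    then show "z \<in> (+) y ` S" by blast
  qed
  moreover have "y - x \<in> S" using vec.subspace_neg[OF S *] by simp
  ultimately show "(+) x ` S = (+) y ` S" using * by blast
qed

lemma coset_eq_self_iff:
  assumes "vec.subspace S" shows "(+) x ` S = S \<longleftrightarrow> x \<in> S"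
  using coset_eq_iff[OF assms, of x 0] by simp

text \<open>Lets maps between quotients be computed on representatives, both for the powers of
  \<open>N\<close> on the weight pieces and for \<open>gr_N\<close>.\<close>

lemma induced_coset:
  assumes S: "vec.subspace S" and A: "(*v) A ` S' \<subseteq> S" and 0: "0 \<in> S'"
  shows "induced A S ((+) x ` S') = (+) (A *v x) ` S"
proof
  show "induced A S ((+) x ` S') \<subseteq> (+) (A *v x) ` S"
  proof
    fix z assume "z \<in> induced A S ((+) x ` S')"
    then obtain s' s where z: "s' \<in> S'" "s \<in> S" "z = A *v (x + s') + s" by (auto simp: induced_def)
    then have "z = A *v x + (A *v s' + s)" "A *v s' + s \<in> S"
      using S A by (auto simp: matrix_vector_right_distrib intro!: vec.subspace_add)
    then show "z \<in> (+) (A *v x) ` S" by blast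
  qed
  show "(+) (A *v x) ` S \<subseteq> induced A S ((+) x ` S')"
    unfolding induced_def using 0 by force
qed

section \<open>Complex conjugation of subspaces\<close>

text \<open>Conjugation is only semilinear, but it still carries spanning sets to spanning sets, so
  it cannot raise the dimension; being an involution, it cannot lower it either.\<close>

lemma dim_cvec_image:
  fixes S :: "(complex ^ 'n) set"
  shows "vec.dim (cvec ` S) = vec.dim S"
proof -
  have add: "cvec (x + y) = cvec x + cvec y" and scale: "cvec (c *s x) = cnj c *s cvec x"
    and zero: "cvec 0 = 0" and inv: "cvec (cvec x) = x" for x y :: "complex ^ 'n" and c
    by (simp_all add: cvec_def vec_eq_iff)
  have le: "vec.dim (cvec ` T) \<le> vec.dim T" for T :: "(complex ^ 'n) set"
  proof -
    obtain B where B: "B \<subseteq> T" "vec.independent B" "T \<subseteq> vec.span B" "card B = vec.dim T"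
      using vec.basis_exists[of T] by auto
    have "cvec x \<in> vec.span (cvec ` B)" if "x \<in> vec.span B" for x
      using that
    proof (induction rule: vec.span_induct_alt)
      case base then show ?case by (simp add: zero vec.span_zero)
    next
      case (step c x y)
      then show ?case unfolding add scale
        by (intro vec.span_add vec.span_scale) (auto intro: vec.span_base)
    qed
    then have "cvec ` T \<subseteq> vec.span (cvec ` B)" using B(3) by blast
    then have "vec.dim (cvec ` T) \<le> card (cvec ` B)"
      using vec.dim_le_card[of "cvec ` T" "cvec ` B"] vec.finiteI_independent[OF B(2)] by simp
    also have "\<dots> \<le> card B" using vec.finiteI_independent[OF B(2)] by (rule card_image_le)
    finally show ?thesis using B(4) by simp
  qed
  have "cvec ` cvec ` S = S" by (simp add: image_image inv)
  then show ?thesis using le[of S] le[of "cvec ` S"] by simp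
qed

lemma subspace_cvec_image:
  fixes S :: "(complex ^ 'n) set"
  assumes S: "vec.subspace S" shows "vec.subspace (cvec ` S)"
proof -
  have *: "cvec x + cvec y = cvec (x + y)" "c *s cvec x = cvec (cnj c *s x)"
    "0 = cvec (0::complex ^ 'n)" for x y :: "complex ^ 'n" and c
    by (simp_all add: cvec_def vec_eq_iff)
  have "0 \<in> cvec ` S" by (subst *(3)) (use S in \<open>auto intro: vec.subspace_0\<close>)
  then show ?thesis unfolding vec.subspace_def
    by (auto simp: *(1,2) intro!: imageI vec.subspace_add[OF S] vec.subspace_scale[OF S])
qed

section \<open>Complexification of rational subspaces\<close>

definition rat_vec :: "rat ^ 'n \<Rightarrow> complex ^ 'n" where
  "rat_vec v = (\<chi> i. of_rat (v $ i))"

lemma rat_vec_simps: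
  "rat_vec (x + y) = rat_vec x + rat_vec y" "rat_vec (c *s x) = of_rat c *s rat_vec x" "rat_vec 0 = 0"
  by (simp_all add: rat_vec_def vec_eq_iff of_rat_add of_rat_mult)

lemma cmat_rat_vec: "cmat A *v rat_vec x = rat_vec (A *v x)"
  by (simp add: cmat_def rat_vec_def vec_eq_iff matrix_vector_mult_def of_rat_sum of_rat_mult)

lemma cmat_mult: "cmat (A ** C) = cmat A ** cmat C"
  by (simp add: cmat_def vec_eq_iff matrix_matrix_mult_def of_rat_sum of_rat_mult)

lemma cmat_mat: "cmat (mat c) = mat (of_rat c)"
  by (simp add: cmat_def vec_eq_iff mat_def)

lemma complexification_eq: "complexification U = vec.span (rat_vec ` U)"
  by (simp add: complexification_def rat_vec_def[abs_def])

lemma subspace_complexification: "vec.subspace (complexification U)"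
  by (simp add: complexification_def)

lemma complexification_mono: "U \<subseteq> V \<Longrightarrow> complexification U \<subseteq> complexification V"
  unfolding complexification_def by (intro vec.span_mono) auto

lemma complexification_span: "complexification (vec.span S) = vec.span (rat_vec ` S)"
proof
  have "rat_vec x \<in> vec.span (rat_vec ` S)" if "x \<in> vec.span S" for x
    using that
  proof (induction rule: vec.span_induct_alt)
    case base then show ?case by (simp add: rat_vec_simps vec.span_zero)
  next
    case (step c x y)
    then show ?case unfolding rat_vec_simps
      by (intro vec.span_add vec.span_scale) (auto intro: vec.span_base)
  qed
  then show "complexification (vec.span S) \<subseteq> vec.span (rat_vec ` S)"
    unfolding complexification_eq by (intro vec.span_minimal) auto
  show "vec.span (rat_vec ` S) \<subseteq> complexification (vec.span S)"
    unfolding complexification_eq by (intro vec.span_mono image_mono vec.span_superset)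
qed

lemma complexification_UNIV: "complexification UNIV = UNIV"
proof -
  have "x \<in> complexification UNIV" for x :: "complex ^ 'n"
  proof -
    have "x = (\<Sum>i\<in>UNIV. (x $ i) *s rat_vec (axis i 1))"
      by (simp add: vec_eq_iff rat_vec_def axis_def if_distrib cong: if_cong)
    also have "\<dots> \<in> complexification UNIV" unfolding complexification_eq
      by (intro vec.span_sum vec.span_scale vec.span_base) auto
    finally show ?thesis .
  qed
  then show ?thesis by auto
qed

lemma complexification_zero: "complexification {0} = {0}"
  by (simp add: complexification_eq rat_vec_simps)

text \<open>Both a rational basis of \<open>U\<close> and a basis of a complement give upper bounds, and these bounds
  add up to the total dimension.\<close>

lemma dim_complexification:
  fixes U :: "(rat ^ 'n) set"
  assumes U: "vec.subspace U"
  shows "vec.dim (complexification U) = vec.dim U"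
proof -
  obtain B where B: "B \<subseteq> U" "vec.independent B" "U \<subseteq> vec.span B" "card B = vec.dim U"
    using vec.basis_exists[of U] by auto
  have spanB: "vec.span B = U" using B U by (meson subset_antisym vec.span_minimal)
  obtain C where C: "B \<subseteq> C" "vec.independent C" "UNIV \<subseteq> vec.span C"
    using vec.maximal_independent_subset_extend[of B UNIV] B(2) by auto
  have fin: "finite B" "finite C" using vec.finiteI_independent B(2) C(2) by auto
  have cardC: "card C = CARD('n)"
    using vec.dim_eq_card[of C UNIV] C(2,3) vec_dim_card[where ?'a = rat and ?'n = 'n]
    by (simp add: top.extremum_unique)
  let ?B = "rat_vec ` B" and ?D = "rat_vec ` (C - B)"
  have le: "vec.dim ?B \<le> card B" "vec.dim ?D \<le> card (C - B)"
    using fin vec.dim_le_card'[of ?B] vec.dim_le_card'[of ?D]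
    by (auto intro: order_trans card_image_le)
  have "vec.span (?B \<union> ?D) = UNIV"
    using complexification_span[of C] C(1,3) complexification_UNIV
    by (metis Diff_partition image_Un top.extremum_unique)
  then have "CARD('n) = vec.dim (vec.span (?B \<union> ?D))" by (simp only: vec_dim_card)
  also have "\<dots> \<le> vec.dim ?B + vec.dim ?D"
    using vec.dim_sums_Int[OF vec.subspace_span vec.subspace_span, of ?B ?D]
    by (simp only: vec.span_Un vec.dim_span)
  also have "\<dots> \<le> vec.dim ?B + (card C - card B)"
    using le(2) card_Diff_subset[OF fin(1) C(1)] by simp
  finally have "card B \<le> vec.dim ?B" using cardC card_mono[OF fin(2) C(1)] by linarith
  then have "vec.dim ?B = card B" using le(1) by simp
  then show ?thesis using complexification_span[of B] B(4) spanB by simp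
qed

text \<open>Spans commute with linear images, and \<open>cmat A\<close> acts on rational vectors as
  \<open>A\<close> does.\<close>

lemma cmat_image_complexification:
  "(*v) (cmat A) ` complexification U = complexification ((*v) A ` U)"
  unfolding complexification_eq vec.span_image[symmetric] image_image cmat_rat_vec ..

lemma matpow_Suc: "matpow A (Suc r) = A ** matpow A r"
  by (simp add: matpow_def)

lemma matpow_0: "matpow A 0 = mat 1"
  by (simp add: matpow_def)

lemma matpow_1 [simp]: "matpow A (Suc 0) = A" and matpow_2: "matpow A 2 = A ** A"
  by (simp_all add: matpow_def numeral_2_eq_2)

subsection \<open>The weight and Hodge filtrations of the limit\<close>

text \<open>All that the linear algebra takes from the geometry: Hodge steps with the dimensions of
  a Calabi-Yau threefold, and \<open>N\<close> shifting both filtrations.\<close>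

locale cy3_limit =
  fixes N :: "rat ^ 'n ^ 'n" and W :: "int \<Rightarrow> (rat ^ 'n) set"
    and F :: "int \<Rightarrow> (complex ^ 'n) set" and k :: nat
  assumes weight: "monodromy_weight_filtration 3 N W"
    and mhs: "mixed_hodge_structure W F"
    and shift: "(*v) (cmat N) ` F j \<subseteq> F (j - 1)"
    and F_0: "F 0 = UNIV" and F_4: "F 4 = {0}"
    and dim_F_3: "vec.dim (F 3) = 1" and dim_F_2: "vec.dim (F 2) = k + 1"
    and card: "CARD('n) = 2 * k + 2"
begin

abbreviation Wc :: "int \<Rightarrow> (complex ^ 'n) set" where "Wc i \<equiv> complexification (W i)"

lemma subspace_W [simp]: "vec.subspace (W i)"
  using weight by (simp add: monodromy_weight_filtration_def increasing_filtration_def)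

lemma subspace_F [simp]: "vec.subspace (F j)"
  using mhs by (simp add: mixed_hodge_structure_def decreasing_filtration_def)

lemma subspace_Wc [simp]: "vec.subspace (Wc i)"
  by (rule subspace_complexification)

lemma W_step: "W (i - 1) \<subseteq> W i"
  using weight unfolding monodromy_weight_filtration_def increasing_filtration_def
  by (metis diff_add_cancel)

lemma W_mono: "i \<le> j \<Longrightarrow> W i \<subseteq> W j"
proof (induction j rule: int_ge_induct)
  case (step j) then show ?case using W_step[of "j + 1"] by auto
qed simp

lemma F_step: "F (j + 1) \<subseteq> F j"
  using mhs by (simp add: mixed_hodge_structure_def decreasing_filtration_def)

lemma card_cart_basis [simp]: "card (cart_basis :: ('a::field ^ 'n) set) = 2 * k + 2"
  using vec_dim_card[where ?'a = 'a and ?'n = 'n] by (simp add: card)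

lemma dim_W_mono: "i \<le> j \<Longrightarrow> vec.dim (W i) \<le> vec.dim (W j)"
  by (intro vec.dim_subset W_mono)

lemma gr_W_dim_eq: "int (gr_W_dim W i) = int (vec.dim (W i)) - int (vec.dim (W (i - 1)))"
  unfolding gr_W_dim_def qdim_def gr_W_def Union_quot[OF subspace_W subspace_W W_step]
  using dim_W_mono[of "i - 1" i] by simp

section \<open>Powers of \<open>N\<close> on the weight graded pieces\<close>

lemma N_W: "x \<in> W i \<Longrightarrow> N *v x \<in> W (i - 2)"
  using weight unfolding monodromy_weight_filtration_def by blast

lemma matpow_W: "x \<in> W i \<Longrightarrow> matpow N r *v x \<in> W (i - 2 * int r)"
proof (induction r)
  case 0 then show ?case by (simp add: matpow_0)
next
  case (Suc r)
  then have "N *v (matpow N r *v x) \<in> W (i - 2 * int r - 2)" by (intro N_W) simp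
  then show ?case by (simp add: matpow_Suc matrix_vector_mul_assoc algebra_simps)
qed

text \<open>The indices \<open>2 + int r\<close> and \<open>2 - int r\<close> are the steps just
  below those of weight \<open>3 + int r\<close> and \<open>3 - int r\<close>, hence the zero
  classes of source and target.\<close>

lemma matpow_coset:
  "induced (matpow N r) (W (2 - int r)) ((+) x ` W (2 + int r)) =
    (+) (matpow N r *v x) ` W (2 - int r)"
proof (rule induced_coset)
  show "(*v) (matpow N r) ` W (2 + int r) \<subseteq> W (2 - int r)"
    using matpow_W[of _ "2 + int r" r] by (auto simp: algebra_simps)
qed (simp_all add: vec.subspace_0)

lemma matpow_bij:
  "bij_betw (induced (matpow N r) (W (2 - int r)))
     ((\<lambda>x. (+) x ` W (2 + int r)) ` W (3 + int r)) ((\<lambda>x. (+) x ` W (2 - int r)) ` W (3 - int r))"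
proof -
  have "3 - int r - 1 = 2 - int r" "3 + int r - 1 = 2 + int r" by simp_all
  then show ?thesis using weight unfolding monodromy_weight_filtration_def gr_W_def quot_def by metis
qed

text \<open>The injective half of the isomorphism between opposite graded pieces, read on
  representatives by comparing the class of \<open>x\<close> with that of \<open>0\<close>.\<close>

lemma matpow_gr_inj:
  assumes x: "x \<in> W (3 + int r)" "matpow N r *v x \<in> W (2 - int r)"
  shows "x \<in> W (2 + int r)"
proof -
  let ?f = "induced (matpow N r) (W (2 - int r))"
  have inj: "inj_on ?f ((\<lambda>x. (+) x ` W (2 + int r)) ` W (3 + int r))"
    using matpow_bij by (rule bij_betw_imp_inj_on)
  have mem: "(+) y ` W (2 + int r) \<in> (\<lambda>x. (+) x ` W (2 + int r)) ` W (3 + int r)"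
    if "y \<in> W (3 + int r)" for y
    using that by (rule imageI)
  have "?f ((+) x ` W (2 + int r)) = ?f ((+) 0 ` W (2 + int r))"
    unfolding matpow_coset using x(2) by (simp add: coset_eq_self_iff)
  then have "(+) x ` W (2 + int r) = (+) 0 ` W (2 + int r)"
    using inj_onD[OF inj _ mem mem, OF _ x(1) vec.subspace_0[OF subspace_W]] by blast
  then show ?thesis by (simp add: coset_eq_self_iff)
qed

lemma matpow_gr_surj:
  assumes "y \<in> W (3 - int r)"
  obtains x where "x \<in> W (3 + int r)" "y - matpow N r *v x \<in> W (2 - int r)"
proof -
  let ?f = "induced (matpow N r) (W (2 - int r))"
  have "(+) y ` W (2 - int r) \<in> ?f ` (\<lambda>x. (+) x ` W (2 + int r)) ` W (3 + int r)"
    using assms unfolding bij_betw_imp_surj_on[OF matpow_bij] by blast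
  then obtain x where "x \<in> W (3 + int r)"
      "(+) y ` W (2 - int r) = (+) (matpow N r *v x) ` W (2 - int r)"
    by (auto simp: matpow_coset)
  then show ?thesis using that by (simp add: coset_eq_iff)
qed

lemma matpow_zero_mono: "R \<le> r \<Longrightarrow> matpow N R = 0 \<Longrightarrow> matpow N r = 0"
proof (induction rule: dec_induct)
  case (step r) then show ?case by (simp add: matpow_Suc)
qed

text \<open>For \<open>r\<close> at least \<open>R\<close> the zero map is injective on the piece of
  weight \<open>3 + r\<close>, so that piece vanishes; the filtration is constant from
  \<open>2 + R\<close> on, and it is exhaustive.\<close>

lemma W_top:
  assumes "matpow N R = 0" shows "W (2 + int R) = UNIV"
proof -
  have *: "W (2 + int (R + m)) \<subseteq> W (2 + int R)" for m
  proof (induction m)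
    case (Suc m)
    have "x \<in> W (2 + int (R + m))" if "x \<in> W (3 + int (R + m))" for x
      using that matpow_zero_mono[OF _ assms, of "R + m"] by (intro matpow_gr_inj) (auto simp: vec.subspace_0)
    then show ?case using Suc by (auto simp: algebra_simps)
  qed simp
  obtain b where "W b = UNIV"
    using weight by (auto simp: monodromy_weight_filtration_def increasing_filtration_def)
  moreover have "W b \<subseteq> W (2 + int (R + nat b))" by (rule W_mono) simp
  ultimately show ?thesis using *[of "nat b"] by auto
qed

text \<open>Dual to \<open>W_top\<close>: for \<open>r\<close> at least \<open>R\<close> the zero
  map is onto the piece of weight \<open>3 - r\<close>.\<close>

lemma W_bottom:
  assumes "matpow N R = 0" shows "W (3 - int R) = {0}"
proof -
  have *: "W (3 - int R) \<subseteq> W (3 - int (R + m))" for m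
  proof (induction m)
    case (Suc m)
    have "y \<in> W (2 - int (R + m))" if "y \<in> W (3 - int (R + m))" for y
      using matpow_gr_surj[OF that] matpow_zero_mono[OF _ assms, of "R + m"] by auto
    then show ?case using Suc by (auto simp: algebra_simps)
  qed simp
  obtain a where "W a = {0}"
    using weight by (auto simp: monodromy_weight_filtration_def increasing_filtration_def)
  \<comment> \<open>The shift \<open>nat (3 - a)\<close> brings the index to at most
    \<open>a\<close>, whatever the sign of \<open>3 - a\<close>.\<close>
  moreover have "W (3 - int (R + nat (3 - a))) \<subseteq> W a" by (rule W_mono) simp
  ultimately show ?thesis using *[of "nat (3 - a)"] vec.subspace_0[OF subspace_W] by fastforce
qed

section \<open>Hodge steps on the weight graded pieces\<close>

lemma dim_Wc [simp]: "vec.dim (Wc i) = vec.dim (W i)"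
  by (simp add: dim_complexification)

lemma Wc_step: "Wc (i - 1) \<subseteq> Wc i"
  by (intro complexification_mono W_step)

text \<open>Integer valued, so that differences of dimensions are not truncated.\<close>

definition dim_FW :: "int \<Rightarrow> int \<Rightarrow> int" where "dim_FW i j = int (vec.dim (F j \<inter> Wc i))"

text \<open>The induced filtration is encoded by preimages, which contain \<open>Wc (i - 1)\<close>;
  this accounts for the last summand.\<close>

lemma dim_induced_filtration:
  "int (vec.dim (induced_filtration F (Wc i) (Wc (i - 1)) j)) =
    dim_FW i j - dim_FW (i - 1) j + int (vec.dim (W (i - 1)))"
proof -
  have "F j \<inter> Wc i \<inter> Wc (i - 1) = F j \<inter> Wc (i - 1)" using Wc_step[of i] by auto
  then show ?thesis
    using dim_subspace_sum[of "F j \<inter> Wc i" "Wc (i - 1)"]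
    by (simp add: induced_filtration_def dim_FW_def vec.subspace_inter)
qed

text \<open>The \<open>j\<close>-th step of the filtration on \<open>Gr\<^sub>i\<close> has dimension \<open>dim_FW i j - dim_FW (i - 1) j\<close>.\<close>

lemma hodge_dim:
  "dim_FW i j - dim_FW (i - 1) j + (dim_FW i (i + 1 - j) - dim_FW (i - 1) (i + 1 - j)) =
    int (vec.dim (W i)) - int (vec.dim (W (i - 1)))"
proof -
  let ?A = "induced_filtration F (Wc i) (Wc (i - 1))"
  have sub: "vec.subspace (?A l)" for l
    unfolding induced_filtration_def by (simp add: subspace_subspace_sum vec.subspace_inter)
  have "subspace_sum (?A j) (cvec ` ?A (i + 1 - j)) = Wc i"
    "?A j \<inter> cvec ` ?A (i + 1 - j) = Wc (i - 1)"
    using mhs by (auto simp: mixed_hodge_structure_def hodge_on_quotient_def)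
  then have "vec.dim (W i) + vec.dim (W (i - 1)) = vec.dim (?A j) + vec.dim (?A (i + 1 - j))"
    using dim_subspace_sum[OF sub subspace_cvec_image[OF sub], of j "i + 1 - j"]
    by (simp add: dim_cvec_image)
  then show ?thesis using dim_induced_filtration[of i j] dim_induced_filtration[of i "i + 1 - j"] by simp
qed

lemma dim_FW_nonneg: "0 \<le> dim_FW i j"
  by (simp add: dim_FW_def)

lemma dim_FW_mono: "dim_FW (i - 1) j \<le> dim_FW i j"
  unfolding dim_FW_def using Wc_step[of i] by (auto intro!: vec.dim_subset)

lemma dim_FW_4 [simp]: "dim_FW i 4 = 0" and dim_FW_0 [simp]: "dim_FW i 0 = int (vec.dim (W i))"
  using vec.subspace_0[OF subspace_Wc, of i] by (simp_all add: dim_FW_def F_0 F_4)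

lemma dim_FW_bottom: "W i = {0} \<Longrightarrow> dim_FW i j = 0"
  by (simp add: dim_FW_def complexification_zero vec.subspace_0)

lemma dim_FW_top: "W i = UNIV \<Longrightarrow> dim_FW i j = int (vec.dim (F j))"
  by (simp add: dim_FW_def complexification_UNIV)

section \<open>The maps induced by \<open>N\<close> on the Hodge graded pieces\<close>

lemma gr_N_coset: "gr_N N F j ((+) x ` F (j + 1)) = (+) (cmat N *v x) ` F j"
  unfolding gr_N_def using shift[of "j + 1"] by (intro induced_coset) (simp_all add: vec.subspace_0)

lemma zero_map_on_gr_N:
  "zero_map_on (gr_N N F j) (gr_F F j) (F j) \<longleftrightarrow> (*v) (cmat N) ` F j \<subseteq> F j"
  by (auto simp: zero_map_on_def gr_F_def quot_def gr_N_coset coset_eq_self_iff)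

lemma zero_map_on_gr_N_comp:
  assumes "N ** N = 0"
  shows "zero_map_on (gr_N N F (j - 1) \<circ> gr_N N F j) (gr_F F j) (F (j - 1))"
proof -
  have "cmat N *v (cmat N *v x) = 0" for x
    by (simp add: matrix_vector_mul_assoc flip: cmat_mult)
       (simp add: assms cmat_def map_matrix_def vec_eq_iff matrix_vector_mult_def)
  then show ?thesis
    using gr_N_coset[of "j - 1"]
    by (auto simp: zero_map_on_def gr_F_def quot_def gr_N_coset coset_eq_self_iff vec.subspace_0)
qed

lemma qdim_gr_N_image:
  "int (qdim (F j) (gr_N N F j ` gr_F F j)) =
    int (vec.dim (subspace_sum ((*v) (cmat N) ` F j) (F j))) - int (vec.dim (F j))"
proof -
  have "gr_N N F j ` gr_F F j = (\<lambda>x. (+) x ` F j) ` (*v) (cmat N) ` F j"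
    by (simp add: gr_F_def quot_def image_image gr_N_coset)
  then have "\<Union> (gr_N N F j ` gr_F F j) = subspace_sum ((*v) (cmat N) ` F j) (F j)"
    by (simp add: Union_cosets)
  then show ?thesis unfolding qdim_def
    using vec.dim_subset[OF subspace_sum_upper2[OF vec.subspace_image[OF subspace_F]],
        of "F j" "cmat N" j]
    by (simp add: of_nat_diff)
qed

lemma qdim_gr_N_kernel:
  "int (qdim (F (j + 1)) {X \<in> gr_F F j. gr_N N F j X = F j}) =
    int (vec.dim {x \<in> F j. cmat N *v x \<in> F j}) - int (vec.dim (F (j + 1)))"
proof -
  let ?K = "{x \<in> F j. cmat N *v x \<in> F j}"
  have sub: "vec.subspace ?K"
    using vec.subspace_inter[OF subspace_F vec.subspace_vimage[OF subspace_F], of j "cmat N" j]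
    by (simp add: vimage_def Int_def)
  have le: "F (j + 1) \<subseteq> ?K" using F_step[of j] shift[of "j + 1"] by auto
  have "{X \<in> gr_F F j. gr_N N F j X = F j} =
      (\<lambda>x. (+) x ` F (j + 1)) ` {x \<in> F j. gr_N N F j ((+) x ` F (j + 1)) = F j}"
    unfolding gr_F_def quot_def by blast
  also have "\<dots> = quot ?K (F (j + 1))"
    by (simp add: quot_def gr_N_coset coset_eq_self_iff)
  finally have "{X \<in> gr_F F j. gr_N N F j X = F j} = quot ?K (F (j + 1))" .
  then show ?thesis unfolding qdim_def using Union_quot[OF sub subspace_F le] vec.dim_subset[OF le]
    by simp
qed

text \<open>Rank-nullity for \<open>N\<close> on \<open>F j\<close> and on the preimage
  \<open>?K\<close> of the kernel of the induced map: both contain the same part of the kernel of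
  \<open>N\<close>, which cancels.\<close>

lemma gr_N_rank_nullity:
  "qdim (F j) (gr_N N F j ` gr_F F j) + qdim (F (j + 1)) {X \<in> gr_F F j. gr_N N F j X = F j}
     + vec.dim (F (j + 1)) = vec.dim (F j)"
proof -
  let ?N = "(*v) (cmat N)"
  let ?K = "{x \<in> F j. cmat N *v x \<in> F j}"
  have sub: "vec.subspace ?K"
    using vec.subspace_inter[OF subspace_F vec.subspace_vimage[OF subspace_F], of j "cmat N" j]
    by (simp add: vimage_def Int_def)
  have NK: "?N ` ?K = ?N ` F j \<inter> F j" by auto
  have ker: "{x \<in> ?K. cmat N *v x = 0} = {x \<in> F j. cmat N *v x = 0}"
    by (auto simp: vec.subspace_0)
  show ?thesis
    using rank_nullity_on[OF sub, of "cmat N"] rank_nullity_on[OF subspace_F, of "cmat N" j]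
      dim_subspace_sum[OF vec.subspace_image[OF subspace_F] subspace_F, of "cmat N" j j]
      qdim_gr_N_image[of j] qdim_gr_N_kernel[of j] unfolding NK ker by linarith
qed

text \<open>The weight filtration jumps only from \<open>W 2\<close> to \<open>W 3\<close>, so the
  Hodge structure on that piece is one on the whole space.\<close>

lemma pure_case:
  assumes "N = 0"
  shows "pure_mixed_hodge_structure 3 W F"
proof -
  have 1: "matpow N 1 = 0" using assms by (simp add: matpow_1)
  have W: "W 3 = UNIV" "W 2 = {0}" using W_top[OF 1] W_bottom[OF 1] by simp_all
  have "gr_W_dim W i = 0" if "i \<noteq> 3" for i
  proof -
    have "i \<ge> 4 \<or> i \<le> 2" using that by linarith
    then have "vec.dim (W i) = vec.dim (W (i - 1))"
    proof
      assume "i \<ge> 4"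
      then have "W i = UNIV" "W (i - 1) = UNIV" using W_mono[of 3 i] W_mono[of 3 "i - 1"] W by auto
      then show ?thesis by simp
    next
      assume "i \<le> 2"
      then have "W i \<subseteq> {0}" "W (i - 1) \<subseteq> {0}" using W_mono[of i 2] W_mono[of "i - 1" 2] W by auto
      then show ?thesis by (metis vec.dim_eq_0)
    qed
    then show ?thesis using gr_W_dim_eq[of i] by simp
  qed
  moreover have "hodge_on_quotient 3 F (Wc 3) (Wc (3 - 1))" "decreasing_filtration F"
    using mhs by (simp_all only: mixed_hodge_structure_def)
  ultimately show ?thesis
    unfolding pure_mixed_hodge_structure_def hodge_structure_def
    using mhs by (simp add: W complexification_UNIV complexification_zero)
qed

section \<open>The case \<open>N ** N = 0\<close>\<close>

context
  assumes N2: "N ** N = 0"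
begin

lemma matpow_2_0: "matpow N 2 = 0"
  using N2 by (simp add: matpow_2)

lemma W_4: "W 4 = UNIV" and W_1: "W 1 = {0}"
  using W_top[OF matpow_2_0] W_bottom[OF matpow_2_0] by simp_all

lemma W_0: "W 0 = {0}"
  using W_mono[of 0 1] W_1 vec.subspace_0[OF subspace_W, of 0] by auto

text \<open>Injectivity of \<open>N\<close> on the piece of weight 4, where \<open>W 4\<close> is
  everything and \<open>W 1\<close> is zero; surjectivity gives \<open>range_N\<close> in the same
  way.\<close>

lemma ker_N: "{x. N *v x = 0} = W 3"
  using matpow_gr_inj[of _ 1] N_W[of _ 3] W_1 W_4
  by (auto simp: matpow_1 vec.subspace_0)

lemma range_N: "range ((*v) N) = W 2"
proof
  show "range ((*v) N) \<subseteq> W 2" using N_W[of _ 4] W_4 by auto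
  show "W 2 \<subseteq> range ((*v) N)"
  proof
    fix y assume "y \<in> W 2"
    then obtain x where "y - matpow N 1 *v x \<in> W 1" using matpow_gr_surj[of y 1] by auto
    then have "y = N *v x" using W_1 by (simp add: matpow_1)
    then show "y \<in> range ((*v) N)" by blast
  qed
qed

lemma dim_W_2: "vec.dim (W 2) + vec.dim (W 3) = 2 * k + 2"
  using rank_nullity_on[of UNIV N] ker_N range_N by simp

lemma range_cmat_N: "range ((*v) (cmat N)) = Wc 2"
  using cmat_image_complexification[of N UNIV] by (simp add: complexification_UNIV range_N)

text \<open>One inclusion complexifies the image of \<open>W 3\<close> under \<open>N\<close>, which
  is zero; counting ranks then gives equality.\<close>

lemma ker_cmat_N: "{x. cmat N *v x = 0} = Wc 3"
proof (rule sym, rule vec.subspace_dim_equal)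
  have "cmat N *v x = 0" if "x \<in> Wc 3" for x
  proof -
    have "(*v) N ` W 3 = {0}" using ker_N vec.subspace_0[OF subspace_W, of 3] by force
    then have "(*v) (cmat N) ` Wc 3 = {0}" by (simp add: cmat_image_complexification complexification_zero)
    then show ?thesis using that by blast
  qed
  then show "Wc 3 \<subseteq> {x. cmat N *v x = 0}" by blast
  show "vec.dim {x. cmat N *v x = 0} \<le> vec.dim (Wc 3)"
    using rank_nullity_on[of UNIV "cmat N"] range_cmat_N dim_W_2 by simp
qed (auto intro: vec.subspace_kernel)

lemma dim_N_F: "int (vec.dim ((*v) (cmat N) ` F j)) = dim_FW 4 j - dim_FW 3 j"
proof -
  have "{x \<in> F j. cmat N *v x = 0} = F j \<inter> Wc 3" using ker_cmat_N by blast
  then show ?thesis using rank_nullity_on[OF subspace_F, of "cmat N" j]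
    unfolding dim_FW_top[OF W_4] by (simp add: dim_FW_def)
qed

lemma N_F_sub: "(*v) (cmat N) ` F j \<subseteq> F (j - 1) \<inter> Wc 2"
  using shift range_cmat_N by blast

text \<open>Strictness of \<open>N\<close> on the Hodge filtration: the inclusion bounds the dimension of
  \<open>F j\<close> on \<open>Gr\<^sub>4\<close> by that of \<open>F (j - 1)\<close> on \<open>Gr\<^sub>2\<close>, and Hodge symmetry
  turns this bound around.\<close>

lemma dim_FW_4_2: "dim_FW 4 j - dim_FW 3 j = dim_FW 2 (j - 1)"
proof -
  have le: "dim_FW 4 j - dim_FW 3 j \<le> dim_FW 2 (j - 1)" for j
    using vec.dim_subset[OF N_F_sub, of j] dim_N_F[of j] by (simp add: dim_FW_def)
  show ?thesis
    \<comment> \<open>Symmetry pairs \<open>j\<close> with \<open>5 - j\<close> in weight 4 and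
      \<open>j - 1\<close> with \<open>4 - j\<close> in weight 2. Both pieces have the dimension of
      \<open>W 2\<close>, so the two bounds have equal sums on either side and must be
      equalities.\<close>
    using le[of j] le[of "5 - j"] hodge_dim[of 4 j] hodge_dim[of 2 "j - 1"] dim_W_2
    by (simp add: dim_FW_bottom[OF W_1] W_1 W_4)
qed

lemma N_F_eq: "(*v) (cmat N) ` F j = F (j - 1) \<inter> Wc 2"
  using N_F_sub dim_N_F[of j] dim_FW_4_2[of j]
  by (intro vec.subspace_dim_equal)
     (auto simp: dim_FW_def intro!: vec.subspace_image vec.subspace_inter)

text \<open>By \<open>N_F_eq\<close>, stability of \<open>F j\<close> says that the filtration on
  \<open>Wc 2\<close> does not jump between \<open>j - 1\<close> and \<open>j\<close>. With
  \<open>zero_map_on_gr_N\<close> this makes the vanishing of an induced map numerical;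
  \<open>rank_gr_N\<close> identifies its rank with the jump.\<close>

lemma F_stable_iff: "(*v) (cmat N) ` F j \<subseteq> F j \<longleftrightarrow> dim_FW 2 (j - 1) = dim_FW 2 j"
proof
  assume "(*v) (cmat N) ` F j \<subseteq> F j"
  then have "F (j - 1) \<inter> Wc 2 = F j \<inter> Wc 2" using F_step[of "j - 1"] by (auto simp: N_F_eq)
  then show "dim_FW 2 (j - 1) = dim_FW 2 j" by (simp add: dim_FW_def)
next
  assume "dim_FW 2 (j - 1) = dim_FW 2 j"
  then have "F j \<inter> Wc 2 = F (j - 1) \<inter> Wc 2"
    using F_step[of "j - 1"]
    by (intro vec.subspace_dim_equal) (auto simp: dim_FW_def intro: vec.subspace_inter)
  then show "(*v) (cmat N) ` F j \<subseteq> F j" by (auto simp: N_F_eq)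
qed

lemma rank_gr_N: "int (qdim (F j) (gr_N N F j ` gr_F F j)) = dim_FW 2 (j - 1) - dim_FW 2 j"
proof -
  have "F (j - 1) \<inter> Wc 2 \<inter> F j = F j \<inter> Wc 2" using F_step[of "j - 1"] by auto
  then show ?thesis
    using dim_subspace_sum[of "F (j - 1) \<inter> Wc 2" "F j"] 
    unfolding qdim_gr_N_image N_F_eq dim_FW_def by (simp add: vec.subspace_inter)
qed

text \<open>Strictness identifies \<open>dim_FW 2 2\<close> with the dimension of the third Hodge
  step in weight 4, which is at most that of \<open>F 3\<close>. Its two possible values separate
  cases (a) and (b).\<close>

lemma dim_FW_2_bounds:
  "dim_FW 2 3 = 0" "dim_FW 2 1 + dim_FW 2 2 = int (vec.dim (W 2))"
  "0 \<le> dim_FW 2 2" "dim_FW 2 2 \<le> 1"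
proof -
  show 3: "dim_FW 2 3 = 0" using dim_FW_4_2[of 4] by simp
  show "dim_FW 2 1 + dim_FW 2 2 = int (vec.dim (W 2))" "0 \<le> dim_FW 2 2" "dim_FW 2 2 \<le> 1"
    using dim_FW_nonneg[of 2 2] dim_FW_nonneg[of 3 3] hodge_dim[of 2 1] dim_FW_4_2[of 3]
      dim_FW_mono[of 3 3] dim_FW_top[OF W_4, of 3] dim_F_3 3
    by (simp_all add: dim_FW_bottom[OF W_1] W_1)
qed

lemma gr_W_dims:
  "int (gr_W_dim W 2) = dim_FW 2 1 + dim_FW 2 2" "int (gr_W_dim W 4) = dim_FW 2 1 + dim_FW 2 2"
  "int (gr_W_dim W 3) = 2 * int k + 2 - 2 * (dim_FW 2 1 + dim_FW 2 2)"
  "gr_W_dim W 0 = 0" "gr_W_dim W 1 = 0" "gr_W_dim W 5 = 0" "gr_W_dim W 6 = 0"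
proof -
  have "W (-1) = {0}" using W_mono[of "-1" 1] W_1 vec.subspace_0[OF subspace_W, of "-1"] by auto
  moreover have "W 5 = UNIV" "W 6 = UNIV" using W_mono[of 4 5] W_mono[of 4 6] W_4 by auto
  ultimately show "int (gr_W_dim W 2) = dim_FW 2 1 + dim_FW 2 2"
    "int (gr_W_dim W 4) = dim_FW 2 1 + dim_FW 2 2"
    "int (gr_W_dim W 3) = 2 * int k + 2 - 2 * (dim_FW 2 1 + dim_FW 2 2)"
    "gr_W_dim W 0 = 0" "gr_W_dim W 1 = 0" "gr_W_dim W 5 = 0" "gr_W_dim W 6 = 0"
    using gr_W_dim_eq[of 0] gr_W_dim_eq[of 1] gr_W_dim_eq[of 2] gr_W_dim_eq[of 3] gr_W_dim_eq[of 4]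
      gr_W_dim_eq[of 5] gr_W_dim_eq[of 6] dim_FW_2_bounds(2) dim_W_2 W_0 W_1 W_4
    by simp_all
qed

lemma W_2_nontrivial:
  assumes "N \<noteq> 0" shows "0 < dim_FW 2 1 + dim_FW 2 2"
proof -
  have "W 2 \<noteq> {0}"
  proof
    assume "W 2 = {0}"
    then have "N *v x = 0" for x using range_N by auto
    then show False using assms by (simp add: matrix_eq)
  qed
  then have "0 < vec.dim (W 2)" using dim_subspace_0_iff[OF subspace_W, of 2] by linarith
  then show ?thesis using dim_FW_2_bounds(2) by simp
qed

text \<open>With \<open>h = dim_FW 2 2\<close>, the ranks of \<open>N1\<close>, \<open>N2\<close>,
  \<open>N3\<close> are \<open>h\<close>, \<open>n2\<close>, \<open>h\<close>, and
  \<open>W 2\<close> has dimension \<open>n2 + 2 * h\<close>. Case (a) is \<open>h = 1\<close>; for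
  \<open>h = 0\<close>, \<open>N\<close> being nonzero forces \<open>N2\<close> to be
  nonzero.\<close>

lemma square_zero_case:
  defines "N1 \<equiv> gr_N N F 3" and "N2 \<equiv> gr_N N F 2" and "N3 \<equiv> gr_N N F 1"
  defines "n2 \<equiv> qdim (F 2) (N2 ` gr_F F 2)"
    and "m2 \<equiv> qdim (F 3) {X \<in> gr_F F 2. N2 X = F 2}"
  defines "case_a \<equiv> \<not> zero_map_on N1 (gr_F F 3) (F 3) \<and> \<not> zero_map_on N3 (gr_F F 1) (F 1) \<and>
      zero_map_on (N2 \<circ> N1) (gr_F F 3) (F 2) \<and> zero_map_on (N3 \<circ> N2) (gr_F F 2) (F 1)"
    and "case_b \<equiv> zero_map_on N1 (gr_F F 3) (F 3) \<and> zero_map_on N3 (gr_F F 1) (F 1) \<and>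
      \<not> zero_map_on N2 (gr_F F 2) (F 2)"
  assumes "N \<noteq> 0"
  shows "(case_a \<or> case_b) \<and> (\<forall>i\<in>{0, 1, 5, 6}. gr_W_dim W i = 0) \<and>
    (case_a \<longrightarrow> (\<forall>i\<in>{2, 4}. gr_W_dim W i = n2 + 2) \<and> int (gr_W_dim W 3) = 2 * (int m2 - 1)) \<and>
    (case_b \<longrightarrow> (\<forall>i\<in>{2, 4}. gr_W_dim W i = n2) \<and> gr_W_dim W 3 = 2 * (m2 + 1))"
proof -
  have zero: "zero_map_on N1 (gr_F F 3) (F 3) \<longleftrightarrow> dim_FW 2 2 = 0"
    "zero_map_on N3 (gr_F F 1) (F 1) \<longleftrightarrow> dim_FW 2 2 = 0"
    "zero_map_on N2 (gr_F F 2) (F 2) \<longleftrightarrow> dim_FW 2 1 = dim_FW 2 2"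
    using dim_FW_2_bounds
    by (auto simp: N1_def N2_def N3_def zero_map_on_gr_N F_stable_iff)
  have comp: "zero_map_on (N2 \<circ> N1) (gr_F F 3) (F 2)" "zero_map_on (N3 \<circ> N2) (gr_F F 2) (F 1)"
    using zero_map_on_gr_N_comp[OF N2, of 3] zero_map_on_gr_N_comp[OF N2, of 2]
    by (simp_all add: N1_def N2_def N3_def)
  have n2: "int n2 = dim_FW 2 1 - dim_FW 2 2" using rank_gr_N[of 2] by (simp add: n2_def N2_def)
  have m2: "int n2 + int m2 = int k"
    using gr_N_rank_nullity[of 2] by (simp add: n2_def m2_def N2_def dim_F_2 dim_F_3)
  consider "dim_FW 2 2 = 0" | "dim_FW 2 2 = 1" using dim_FW_2_bounds(3,4) by linarith
  then show ?thesis
  proof cases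
    case 1
    then show ?thesis using W_2_nontrivial[OF \<open>N \<noteq> 0\<close>] gr_W_dims n2 m2
      unfolding case_a_def case_b_def zero by auto
  next
    case 2
    then show ?thesis using gr_W_dims n2 m2 comp unfolding case_a_def case_b_def zero by auto
  qed
qed

end

section \<open>The case \<open>N ** N ** N = 0\<close> with \<open>N ** N\<close> nonzero\<close>

text \<open>\<open>N\<close> maps \<open>W 3\<close> onto \<open>W 1\<close> and \<open>W 4\<close>
  onto \<open>W 2\<close>, and its kernel lies in \<open>W 3\<close>. Rank-nullity then expresses
  all dimensions through those of \<open>W 1\<close> and of the kernel within the range; Hodge
  symmetry in weight 5 fixes \<open>W 1\<close>.\<close>

lemma cube_zero_case:
  assumes N2: "N ** N \<noteq> 0" and N3: "N ** N ** N = 0"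
  defines "d_o \<equiv> vec.dim ({v. N *v v = 0} \<inter> range ((*v) N))"
  shows "(\<forall>i\<in>{0, 6}. gr_W_dim W i = 0) \<and> (\<forall>i\<in>{1, 5}. gr_W_dim W i = 2) \<and>
    (\<forall>i\<in>{2, 4}. int (gr_W_dim W i) = int d_o - 2) \<and>
    int (gr_W_dim W 3) = 2 * (int k + 1 - int d_o)"
proof -
  have 3: "matpow N 3 = 0"
    using N3 by (simp add: numeral_3_eq_3 matpow_Suc matpow_0 matrix_mul_assoc)
  have W_5: "W 5 = UNIV" and W_0: "W 0 = {0}" using W_top[OF 3] W_bottom[OF 3] by simp_all
  have W_6: "W 6 = UNIV" using W_mono[of 5 6] W_5 by auto
  have W_neg: "W (-1) = {0}"
    using W_mono[of "-1" 0] W_0 vec.subspace_0[OF subspace_W, of "-1"] by auto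
  have ker2: "{x. matpow N 2 *v x = 0} = W 4"
    using matpow_gr_inj[of _ 2] matpow_W[of _ 4 2] W_0 W_5 by auto
  have range2: "range ((*v) (matpow N 2)) = W 1"
  proof
    show "range ((*v) (matpow N 2)) \<subseteq> W 1" using matpow_W[of _ 5 2] W_5 by auto
    show "W 1 \<subseteq> range ((*v) (matpow N 2))"
    proof
      fix y assume "y \<in> W 1"
      then obtain x where "y - matpow N 2 *v x \<in> W 0" using matpow_gr_surj[of y 2] by auto
      then have "y = matpow N 2 *v x" using W_0 by simp
      then show "y \<in> range ((*v) (matpow N 2))" by blast
    qed
  qed
  have N_range: "(*v) N ` range ((*v) N) = W 1"
    using range2 by (simp add: matpow_2 image_image matrix_vector_mul_assoc)
  \<comment> \<open>Two descents: the kernel of \<open>N\<close> lies in that of its square, which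
    is \<open>W 4\<close>, and injectivity in weight 4 then lowers it to \<open>W 3\<close>.\<close>
  have ker: "{x. N *v x = 0} \<subseteq> W 3"
  proof
    fix x assume x: "x \<in> {x. N *v x = 0}"
    then have "matpow N 2 *v x = 0" by (simp add: matpow_2 flip: matrix_vector_mul_assoc)
    then have "x \<in> W 4" using ker2 by blast
    then show "x \<in> W 3" using x matpow_gr_inj[of x 1] by (simp add: matpow_1 vec.subspace_0)
  qed
  have N_W_3: "(*v) N ` W 3 = W 1"
  proof
    show "(*v) N ` W 3 \<subseteq> W 1" using N_W[of _ 3] by auto
    have "range ((*v) N) \<subseteq> W 3" using N_W[of _ 5] W_5 by auto
    then show "W 1 \<subseteq> (*v) N ` W 3" using N_range by blast
  qed
  have N_W_4: "(*v) N ` W 4 = W 2"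
  proof
    show "(*v) N ` W 4 \<subseteq> W 2" using N_W[of _ 4] by auto
    show "W 2 \<subseteq> (*v) N ` W 4"
    proof
      fix y assume "y \<in> W 2"
      then obtain x where x: "x \<in> W 4" "y - N *v x \<in> W 1"
        using matpow_gr_surj[of y 1] by (auto simp: matpow_1)
      \<comment> \<open>Surjectivity in weight 2 holds only modulo \<open>W 1\<close>; the error is
        itself an image from \<open>W 3\<close> and is absorbed into the preimage.\<close>
      then obtain z where z: "z \<in> W 3" "y - N *v x = N *v z" using N_W_3 by blast
      then have "y = N *v (x + z)" by (simp add: matrix_vector_right_distrib algebra_simps)
      moreover have "x + z \<in> W 4"
        using x z W_mono[of 3 4] by (intro vec.subspace_add[OF subspace_W]) auto
      ultimately show "y \<in> (*v) N ` W 4" by blast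
    qed
  qed
  have ker_W: "{x \<in> W i. N *v x = 0} = {x. N *v x = 0}" if "3 \<le> i" for i
    using ker W_mono[OF that] by auto
  have range_ker: "{x \<in> range ((*v) N). N *v x = 0} = {v. N *v v = 0} \<inter> range ((*v) N)" by auto
  have dims: "vec.dim (W 1) + vec.dim (W 4) = 2 * k + 2"
    "vec.dim (W 1) + vec.dim {x. N *v x = 0} = vec.dim (W 3)"
    "vec.dim (W 2) + vec.dim {x. N *v x = 0} = vec.dim (W 4)"
    "vec.dim (range ((*v) N)) + vec.dim {x. N *v x = 0} = 2 * k + 2"
    "vec.dim (W 1) + d_o = vec.dim (range ((*v) N))"
    using rank_nullity_on[of UNIV "matpow N 2"] rank_nullity_on[OF subspace_W, of N 3]
      rank_nullity_on[OF subspace_W, of N 4] rank_nullity_on[of UNIV N]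
      rank_nullity_on[OF vec.subspace_image[OF vec.subspace_UNIV], of N N]
    by (simp_all add: ker2 range2 N_W_3 N_W_4 ker_W N_range range_ker d_o_def)
  have "W 1 \<noteq> {0}"
  proof
    assume "W 1 = {0}"
    then have "matpow N 2 *v x = 0" for x using range2 by auto
    then have "matpow N 2 = 0" by (simp add: matrix_eq)
    then show False using N2 by (simp add: matpow_2)
  qed
  then have "0 < vec.dim (W 1)" using dim_subspace_0_iff[OF subspace_W, of 1] by linarith
  \<comment> \<open>In weight 5 the step 3 is paired with itself. As \<open>W 1\<close> is nonzero,
    \<open>dim_FW 4 3\<close> must vanish.\<close>
  moreover have "int (vec.dim (W 1)) = 2 - 2 * dim_FW 4 3"
    using hodge_dim[of 5 3] dims(1) dim_FW_top[OF W_5, of 3] dim_F_3 W_5 by simp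
  moreover from calculation have "dim_FW 4 3 < 1" by linarith
  ultimately have dim_W_1: "vec.dim (W 1) = 2" using dim_FW_nonneg[of 4 3] by simp
  show ?thesis
    using dims dim_W_1 gr_W_dim_eq[of 0] gr_W_dim_eq[of 1] gr_W_dim_eq[of 2] gr_W_dim_eq[of 3]
      gr_W_dim_eq[of 4] gr_W_dim_eq[of 5] gr_W_dim_eq[of 6] W_0 W_5 W_6 W_neg
    by simp
qed

end

subsection \<open>Dimensions of the limiting Hodge filtration\<close>

lemma mat_mult_vec: "mat c *v x = c *s (x :: 'a::field ^ 'n)"
  by (simp add: mat_def matrix_vector_mult_def vec_eq_iff if_distrib if_distribR cong: if_cong)

lemma sum_matrix_vector_mult:
  fixes M :: "'i \<Rightarrow> 'a::field ^ 'n ^ 'm"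
  shows "(\<Sum>j\<in>S. M j) *v x = (\<Sum>j\<in>S. M j *v x)"
  by (induction S rule: infinite_finite_induct) (simp_all add: matrix_vector_mult_add_rdistrib)

text \<open>The exponential is the identity plus terms that lower the filtration, so a vector in its
  kernel descends step by step to zero. No product formula for truncated exponentials
  enters.\<close>

lemma inj_nilp_exp:
  fixes M :: "'a::field_char_0 ^ 'n ^ 'n" and V :: "int \<Rightarrow> ('a ^ 'n) set"
  assumes sub: "\<And>i. vec.subspace (V i)" and step: "\<And>i. V (i - 1) \<subseteq> V i"
    and M: "\<And>i. (*v) M ` V i \<subseteq> V (i - 1)"
    and bot: "V a = {0}" and top: "V b = UNIV"
  shows "inj ((*v) (nilp_exp M))"
proof -
  have pow: "matpow M (Suc j) *v v \<in> V (i - 1)" if "v \<in> V i" for i j v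
  proof (induction j)
    case 0 then show ?case using that M by (auto simp: matpow_def)
  next
    case (Suc j)
    then have "M *v (matpow M (Suc j) *v v) \<in> V (i - 1 - 1)" using M by blast
    then show ?case using step[of "i - 1"] by (auto simp: matpow_def matrix_vector_mul_assoc)
  qed
  have descend: "v \<in> V (i - 1)" if "v \<in> V i" "nilp_exp M *v v = 0" for i v
  proof -
    let ?t = "\<lambda>j. mat (1 / fact j) ** matpow M j"
    have "nilp_exp M = ?t 0 + (\<Sum>j = 1..CARD('n). ?t j)"
      by (simp add: nilp_exp_def sum.atLeast_Suc_atMost)
    then have "v = - (\<Sum>j = 1..CARD('n). ?t j *v v)"
      using that(2)
      by (simp add: matpow_def matrix_vector_mult_add_rdistrib eq_neg_iff_add_eq_0 sum_matrix_vector_mult)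
    moreover have "?t j *v v \<in> V (i - 1)" if "j \<in> {1..CARD('n)}" for j
    proof -
      have "?t j *v v = (1 / fact j) *s (matpow M j *v v)"
        by (simp add: mat_mult_vec flip: matrix_vector_mul_assoc)
      moreover have "matpow M j *v v \<in> V (i - 1)"
        using pow[OF \<open>v \<in> V i\<close>, of "j - 1"] that by simp
      ultimately show ?thesis using sub by (simp add: vec.subspace_scale)
    qed
    ultimately show ?thesis
      using sub by (metis (no_types, lifting) vec.subspace_neg vec.subspace_sum)
  qed
  have "v = 0" if v: "nilp_exp M *v v = 0" for v
  proof -
    have "v \<in> V (b - int m)" for m
    proof (induction m)
      case 0 then show ?case by (simp add: top)
    next
      case (Suc m) then show ?case using descend[of v "b - int m", OF _ v] by (simp add: algebra_simps)
    qed
    moreover have "V (a - int m) \<subseteq> V a" for m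
    proof (induction m)
      case (Suc m) then show ?case using step[of "a - int m"] by (auto simp: algebra_simps)
    qed simp
    \<comment> \<open>Both sides are the minimum of \<open>a\<close> and \<open>b\<close>, so either
      order of the two indices is covered.\<close>
    moreover have "b - int (nat (b - a)) = a - int (nat (a - b))" by simp
    ultimately show ?thesis using bot by (metis singletonD subsetD)
  qed
  then show ?thesis by (simp add: vec.inj_iff_eq_0)
qed

text \<open>Transport along the reversed path is a left inverse, since a path followed by its
  reverse is homotopic to a constant one.\<close>

lemma inj_cmat_transport:
  assumes tr: "local_system B tr" and g: "path g" "path_image g \<subseteq> B"
  shows "inj ((*v) (cmat (tr g)))"
proof -
  have "pathstart g \<in> B" using g by auto
  moreover have "tr (g +++ reversepath g) = tr (linepath (pathstart g) (pathstart g))"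
    using homotopic_paths_rinv[OF g] tr by (auto simp: local_system_def)
  moreover have "tr (g +++ reversepath g) = tr (reversepath g) ** tr g"
    using tr g by (simp add: local_system_def)
  ultimately have "tr (reversepath g) ** tr g = mat 1"
    using tr by (simp add: local_system_def)
  then have "cmat (tr (reversepath g)) ** cmat (tr g) = mat 1"
    by (simp add: cmat_mat flip: cmat_mult)
  then show ?thesis
    by (metis inj_on_inverseI matrix_vector_mul_assoc matrix_vector_mul_lid)
qed

text \<open>The exponential factor has modulus \<open>exp (- 2 * pi * Im z)\<close>, which is
  positive and at most 1 here.\<close>

lemma pcover_in_punctured_disc:
  assumes "0 < r" "0 \<le> Im z" shows "pcover p r z \<in> cball p r - {p}"
  using assms by (simp add: pcover_def dist_norm norm_mult)

lemma path_pcover: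
  assumes "0 < r" "0 \<le> Im z"
  shows "path (pcover p r \<circ> linepath z 0)" "path_image (pcover p r \<circ> linepath z 0) \<subseteq> cball p r - {p}"
proof -
  show "path (pcover p r \<circ> linepath z 0)"
    unfolding path_def pcover_def linepath_def o_def by (intro continuous_intros)
  have "pcover p r (linepath z 0 s) \<in> cball p r - {p}" if "s \<in> {0..1}" for s
    using assms that by (intro pcover_in_punctured_disc) (simp_all add: linepath_def)
  then show "path_image (pcover p r \<circ> linepath z 0) \<subseteq> cball p r - {p}"
    by (auto simp: path_image_def)
qed

lemma eventually_Im_at_top_witness:
  assumes "\<forall>\<^sub>F z in filtercomap Im at_top. P z"
  obtains z where "0 \<le> Im z" "P z"
proof -
  obtain c where "\<And>z. c \<le> Im z \<Longrightarrow> P z"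
    using assms unfolding eventually_filtercomap eventually_at_top_linorder by blast
  then show ?thesis using that[of "Complex 0 (max c 0)"] by simp
qed

section \<open>From the fibres to the limit\<close>

text \<open>\<open>F j\<close> and the conjugate of \<open>F (4 - j)\<close> are complementary.
  Moreover \<open>F 2\<close> and the conjugate of \<open>F 1\<close> span everything and meet in
  the (2,1)-part; solving the resulting dimension equations gives the claims.\<close>

lemma hodge_structure_CY3_dims:
  fixes F :: "int \<Rightarrow> (complex ^ 'n) set"
  assumes "hodge_structure 3 F" and F_0: "F 0 = UNIV"
    and h30: "vec.dim (hodge_component F 3 0) = 1" and h21: "vec.dim (hodge_component F 2 1) = k"
  shows "F 4 = {0}" "vec.dim (F 3) = 1" "vec.dim (F 2) = k + 1" "CARD('n) = 2 * k + 2"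
proof -
  have sub1: "vec.subspace (F j)" and F_step: "F (j + 1) \<subseteq> F j" for j
    using assms(1) by (simp_all add: hodge_structure_def decreasing_filtration_def)
  note sub = sub1 subspace_cvec_image[OF sub1]
  have conj_UNIV: "cvec ` F 0 = UNIV"
    unfolding F_0 by (rule surjI[of _ cvec]) (simp add: cvec_def vec_eq_iff)
  have ind: "induced_filtration F UNIV {0} j = F j" for j
    by (auto simp: induced_filtration_def subspace_sum_def)
  have split: "subspace_sum (F j) (cvec ` F (4 - j)) = UNIV" "F j \<inter> cvec ` F (4 - j) = {0}" for j
    using assms(1) by (auto simp: hodge_structure_def hodge_on_quotient_def ind)
  have dims: "vec.dim (F j) + vec.dim (F (4 - j)) = CARD('n)" for j
    using dim_subspace_sum[OF sub(1) sub(2), of j "4 - j"] split[of j]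
    by (simp add: dim_cvec_image vec_dim_card del: vec.dim_UNIV)
  show "F 4 = {0}" using split(2)[of 4] conj_UNIV by simp
  show 3: "vec.dim (F 3) = 1" using h30 conj_UNIV by (simp add: hodge_component_def)
  have "subspace_sum (F 2) (cvec ` F 1) = UNIV"
    using split(1)[of 2] F_step[of 1] by (auto simp: subspace_sum_def set_eq_iff) blast
  then have "CARD('n) + k = vec.dim (F 2) + vec.dim (F 1)"
    using dim_subspace_sum[OF sub(1) sub(2), of 2 1] h21
    by (simp add: dim_cvec_image vec_dim_card hodge_component_def del: vec.dim_UNIV)
  then show "vec.dim (F 2) = k + 1" "CARD('n) = 2 * k + 2"
    using dims[of 2] dims[of 3] 3 by simp_all
qed

text \<open>Convergence of subspaces includes eventual equality of dimensions, so one point high in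
  the half plane suffices: there both the transport and the exponential twist are injective. The
  complexified weight filtration supplies the descent for \<open>inj_nilp_exp\<close>.\<close>

lemma dim_limit_hodge_filtration:
  assumes tr: "local_system B tr" and puncture: "0 < r" "cball p r - {p} \<subseteq> B"
    and F: "\<And>t. t \<in> B \<Longrightarrow> vec.subspace (F j t)"
    and limit: "limit_mixed_hodge_structure w tr F p r N W Finf"
  obtains t where "t \<in> B" "vec.dim (Finf j) = vec.dim (F j t)"
proof -
  have incr: "increasing_filtration W" and N_W: "(*v) N ` W i \<subseteq> W (i - 2)" for i
    using limit by (simp_all add: limit_mixed_hodge_structure_def monodromy_weight_filtration_def)
  have W: "vec.subspace (W i)" "W (i - 1) \<subseteq> W i" for i
    using incr unfolding increasing_filtration_def by (simp, metis diff_add_cancel)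
  obtain a b where ab: "W a = {0}" "W b = UNIV"
    using incr unfolding increasing_filtration_def by meson
  have inj: "inj ((*v) (nilp_exp (mat z ** cmat N)))" for z
  proof (rule inj_nilp_exp)
    show "vec.subspace (complexification (W i))" for i by (rule subspace_complexification)
    show "complexification (W (i - 1)) \<subseteq> complexification (W i)" for i
      by (intro complexification_mono W)
    show "complexification (W a) = {0}" "complexification (W b) = UNIV"
      by (simp_all add: ab complexification_zero complexification_UNIV)
    show "(*v) (mat z ** cmat N) ` complexification (W i) \<subseteq> complexification (W (i - 1))" for i
    proof -
      have "(*v) (cmat N) ` complexification (W i) \<subseteq> complexification (W (i - 1))"
        unfolding cmat_image_complexification using N_W[of i] W(2)[of "i - 1"]
        by (intro complexification_mono) auto
      then show ?thesis
        by (auto simp: mat_mult_vec simp flip: matrix_vector_mul_assoc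
            intro!: vec.subspace_scale subspace_complexification)
    qed
  qed
  have "\<forall>\<^sub>F z in filtercomap Im at_top.
      vec.dim ((*v) (nilp_exp (mat z ** cmat N)) ` period_map tr F p r j z) = vec.dim (Finf j)"
    using limit by (auto simp: limit_mixed_hodge_structure_def limit_hodge_filtration_def
        subspace_tendsto_def elim: eventually_mono)
  then obtain z where z: "0 \<le> Im z"
      "vec.dim ((*v) (nilp_exp (mat z ** cmat N)) ` period_map tr F p r j z) = vec.dim (Finf j)"
    by (rule eventually_Im_at_top_witness)
  have injT: "inj ((*v) (cmat (tr (pcover p r \<circ> linepath z 0))))"
    using path_pcover[OF puncture(1) z(1)] puncture(2) by (intro inj_cmat_transport[OF tr]) auto
  have "vec.dim (Finf j) = vec.dim (F j (pcover p r z))"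
    unfolding z(2)[symmetric] period_map_def
    using inj injT by (simp add: vec.dim_image_eq inj_on_subset[OF _ subset_UNIV])
  then show ?thesis using that pcover_in_punctured_disc[OF puncture(1) z(1)] puncture(2) by blast
qed

theorem proposition24:
  fixes G0 G1 :: "complex ^ 5 \<Rightarrow> complex" and m k :: nat and B :: "complex set"
    and ev :: "complex \<Rightarrow> rat ^ 'n \<Rightarrow> ((mat5 \<times> mat5) chain) set \<Rightarrow> rat"
    and tr :: "(real \<Rightarrow> complex) \<Rightarrow> rat ^ 'n ^ 'n"
    and F :: "int \<Rightarrow> complex \<Rightarrow> (complex ^ 'n) set" and Q :: "complex \<Rightarrow> rat ^ 'n ^ 'n"
    and p :: complex and r :: real and Ts Tu N :: "rat ^ 'n ^ 'n"
    and W :: "int \<Rightarrow> (rat ^ 'n) set" and Finf :: "int \<Rightarrow> (complex ^ 'n) set"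
    and N1 N2 N3 :: "(complex ^ 'n) set \<Rightarrow> (complex ^ 'n) set"
    and n2 m2 d_o :: nat
  assumes pencil: "is_quintic_pencil G0 G1"
    and B: "B = equisingular_locus m G0 G1"
    and R3: "third_cohomology_local_system G0 G1 B ev tr"
    and vhs: "variation_of_hodge_structure 3 B tr F" "polarization 3 B tr F Q"
    and effective: "\<And>t. t \<in> B \<Longrightarrow> F 0 t = UNIV"
    and hodge_numbers:
      "\<And>t. t \<in> B \<Longrightarrow> vec.dim (hodge_component (\<lambda>j. F j t) 3 0) = 1"
      "\<And>t. t \<in> B \<Longrightarrow> vec.dim (hodge_component (\<lambda>j. F j t) 2 1) = k"
      "\<And>t. t \<in> B \<Longrightarrow> vec.dim (hodge_component (\<lambda>j. F j t) 1 2) = k"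
      "\<And>t. t \<in> B \<Longrightarrow> vec.dim (hodge_component (\<lambda>j. F j t) 0 3) = 1"
    and puncture: "p \<notin> B" "0 < r" "cball p r - {p} \<subseteq> B"
    and monodromy: "jordan_decomposition (local_monodromy tr p r) Ts Tu"
    and N: "N = unip_log Tu"
    and limit: "limit_mixed_hodge_structure 3 tr F p r N W Finf"
    and N_maps: "N1 = gr_N N Finf 3" "N2 = gr_N N Finf 2" "N3 = gr_N N Finf 1"
    and n2: "n2 = qdim (Finf 2) (N2 ` gr_F Finf 2)"
    and m2: "m2 = qdim (Finf 3) {X \<in> gr_F Finf 2. N2 X = Finf 2}"
    and d_o: "d_o = vec.dim ({v. N *v v = 0} \<inter> range ((*v) N))"
  shows "(N = 0 \<longrightarrow> pure_mixed_hodge_structure 3 W Finf) \<and>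
    (N \<noteq> 0 \<and> N ** N = 0 \<longrightarrow>
      (let case_a = \<not> zero_map_on N1 (gr_F Finf 3) (Finf 3) \<and>
                    \<not> zero_map_on N3 (gr_F Finf 1) (Finf 1) \<and>
                    zero_map_on (N2 \<circ> N1) (gr_F Finf 3) (Finf 2) \<and>
                    zero_map_on (N3 \<circ> N2) (gr_F Finf 2) (Finf 1);
           case_b = zero_map_on N1 (gr_F Finf 3) (Finf 3) \<and>
                    zero_map_on N3 (gr_F Finf 1) (Finf 1) \<and>
                    \<not> zero_map_on N2 (gr_F Finf 2) (Finf 2)
       in (case_a \<or> case_b) \<and>
          (\<forall>i\<in>{0, 1, 5, 6}. gr_W_dim W i = 0) \<and>
          (case_a \<longrightarrow> (\<forall>i\<in>{2, 4}. gr_W_dim W i = n2 + 2) \<and>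
                       int (gr_W_dim W 3) = 2 * (int m2 - 1)) \<and>
          (case_b \<longrightarrow> (\<forall>i\<in>{2, 4}. gr_W_dim W i = n2) \<and>
                       gr_W_dim W 3 = 2 * (m2 + 1)))) \<and>
    (N ** N \<noteq> 0 \<and> N ** N ** N = 0 \<longrightarrow>
      (\<forall>i\<in>{0, 6}. gr_W_dim W i = 0) \<and>
      (\<forall>i\<in>{1, 5}. gr_W_dim W i = 2) \<and>
      (\<forall>i\<in>{2, 4}. int (gr_W_dim W i) = int d_o - 2) \<and>
      int (gr_W_dim W 3) = 2 * (int k + 1 - int d_o))"
proof -
  have tr: "local_system B tr" and hodge: "\<And>t. t \<in> B \<Longrightarrow> hodge_structure 3 (\<lambda>j. F j t)"
    using vhs(1) by (auto simp: variation_of_hodge_structure_def)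
  have sub: "vec.subspace (F j t)" if "t \<in> B" for j t
    using hodge[OF that] by (simp add: hodge_structure_def decreasing_filtration_def)
  note fibre_dims = hodge_structure_CY3_dims[OF hodge effective hodge_numbers(1,2)]
  \<comment> \<open>The fibre supplied by the limit lemma is unspecified, which is harmless as these
    dimensions are constant over \<open>B\<close>.\<close>
  have dim_eq: "vec.dim (Finf j) = e" if "\<And>t. t \<in> B \<Longrightarrow> vec.dim (F j t) = e" for j e
    using dim_limit_hodge_filtration[OF tr puncture(2,3) sub limit, of j] that by metis
  have mhs: "monodromy_weight_filtration 3 N W" "mixed_hodge_structure W Finf"
    and shift: "\<And>j. (*v) (cmat N) ` Finf j \<subseteq> Finf (j - 1)"
    using limit by (auto simp: limit_mixed_hodge_structure_def)
  have sub_inf: "vec.subspace (Finf j)" for j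
    using mhs(2) by (simp add: mixed_hodge_structure_def decreasing_filtration_def)
  interpret cy3_limit N W Finf k
  proof
    have "vec.dim (Finf 0) = CARD('n)"
      by (rule dim_eq) (simp add: effective vec_dim_card del: vec.dim_UNIV)
    then show "Finf 0 = UNIV"
      using sub_inf[of 0]
      by (intro vec.subspace_dim_equal) (simp_all add: vec_dim_card del: vec.dim_UNIV)
    have "vec.dim (Finf 4) = 0" by (rule dim_eq) (simp add: fibre_dims(1))
    then show "Finf 4 = {0}" using sub_inf dim_subspace_0_iff by blast
    show "vec.dim (Finf 3) = 1" by (rule dim_eq) (rule fibre_dims(2))
    show "vec.dim (Finf 2) = k + 1" by (rule dim_eq) (rule fibre_dims(3))
    \<comment> \<open>The base point of the covering witnesses that \<open>B\<close> is nonempty;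
      the total dimension is then read off at that fibre.\<close>
    have "p + of_real r \<in> cball p r - {p}" using puncture(2) by (simp add: dist_norm)
    then have "p + of_real r \<in> B" using puncture(3) by blast
    then show "CARD('n) = 2 * k + 2" using fibre_dims(4) by blast
  qed (use mhs shift in auto)
  show ?thesis
    unfolding Let_def n2 m2 d_o N_maps
    by (rule conjI[OF impI conjI[OF impI impI]])
       (erule pure_case,
        erule conjE, rule square_zero_case, assumption, assumption,
        erule conjE, rule cube_zero_case, assumption, assumption)
qed

end
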